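(* (1) Let $n\in\omega$, let $s\in\mathcal S(n+1)$, let $W(s)=\mathrm{ran}(\mathrm{wt}^s)$, and for each $k\in W(s)$ let $U_k$ be a uniform chain of rank $\omega$ such that $\mathrm f U_k\cong\mathrm f U_l$ for all $k,l\in W(s)$. Then the chain $\mathcal A(s)\{\langle U_k,k\rangle : k\in W(s)\}$ is a uniform chain of rank $\omega+n$. (2) Every uniform decomposable chain $A$ with $\omega<\mathrm{rk}(A)<\omega+\omega$ is isomorphic to a chain $\mathcal A(s)\{\langle U_k,k\rangle : k\in W(s)\}$ of this form.
   Context: A chain is a linearly ordered set; $\cong$ is order isomorphism. $A+B$ and $\sum_{i\in I}A_i$ are ordered sums, $AB=\sum_{b\in B}A$ is the anti-lexicographically ordered product; $\mathbb N,\mathbb Z$ have their usual orders and $1$ is the one-element chain. For a chain $A$ define convex equivalence relations $\rho_\alpha$ ($\alpha$ an ordinal): $\rho_0$ is equality; $A/\alpha$ is the quotient chain of $\rho_\alpha$-classes and $[x]_\alpha$ (the $\alpha$-component of $x$) is the class of $x$; $x\rho_{\alpha+1}y$ iff the interval between $[x]_\alpha$ and $[y]_\alpha$ in $A/\alpha$ is finite; for limit $\alpha$, $x\rho_\alpha y$ iff $x\rho_\beta y$ for some $\beta<\alpha$. The rank $\mathrm{rk}(A)$ is the least $\alpha$ with $A/\alpha\cong 1$; $A$ is decomposable if its rank is defined. All chains are assumed decomposable. $A$ is uniform if $A^{\ge x}=\{y\in A:x\le y\}$ has the same order type for all $x\in A$; then $\mathrm f A$ denotes this common tail. $\mathcal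 S(m)$ is the set of sequences $s=(s(0),\dots,s(m-1))$ of natural numbers with $s(i)\le i$ for all $i<m$; $|s|=m$ is the length. For $s$ of length $n+1\ge2$: $s^-$ is $s$ with its last entry deleted, and $s^+$ is $s$ with its next-to-last entry $s(n-1)$ deleted; $s^+\in\mathcal S(n)$ iff $s(n)<n$. The tree of $s$ (nonempty) has root $(s;0)$; a node $(t;k)$ with $|t|=m+1\ge 2$ has the single child $(t^-;0)$ if $t(m)=m$, and a left child $(t^+;k+1)$ and a right child $(t^-;0)$ if $t(m)<m$. The leaves are the nodes $(\langle 0\rangle;k)$ on level $|s|-1$, ordered from left to right; $\ell(s)$ is their number and $\mathrm{wt}^s(i)=k$ if the $i$th leaf ($0\le i<\ell(s)$) is $(\langle0\rangle;k)$. For uniform chains $M_i$ of rank $\omega$: $\mathcal A(\langle0\rangle)[M_0]=M_0$, and for $s$ of length $n+1\ge 2$, $\mathcal A(s)[M_0,\dots,M_{\ell(s)-1}]=\mathcal A(s^-)[M_0,\dots,M_{\ell(s^-)-1}]\,\mathbb Z$ if $s(n)=n$ (then $\ell(s)=\ell(s^-)$), and $=\mathcal A(s^+)[M_0,\dots,M_{\ell(s^+)-1}]+\mathcal A(s^-)[M_{\ell(s^+)},\dots,M_{\ell(s)-1}]\,\mathbb N$ if $s(n)<n$ (then $\ell(s)=\ell(s^+)+\ell(s^-)$). Finally $\mathcal A(s)\{\langle U_k,k\rangle:k\in W(s)\}:=\mathcal A(s)[M_0,\dots,M_{\ell(s)-1}]$ with $M_i=U_{\mathrm{wt}^s(i)}$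 for $i<\ell(s)$. *)

theory Defs
  imports Main
begin

unbundle cardinal_syntax

text \<open>
  A chain is a reflexive linear order, given as a relation \<open>A :: 'a rel\<close> with
  \<open>Linear_order A\<close>; its carrier is \<open>Field A\<close>. Ordinals are represented by
  well-order relations (up to \<open>=o\<close>, compared by \<open><o\<close>), on an arbitrary type.
\<close>

subsection \<open>Chains\<close>

definition chain_iso :: "'a rel \<Rightarrow> 'b rel \<Rightarrow> bool"  (infix "\<cong>" 50) where
  "A \<cong> B \<longleftrightarrow> (\<exists>f. iso A B f)"

definition one_chain :: "unit rel" where
  "one_chain = {((), ())}"

definition int_chain :: "int rel" where
  "int_chain = {(x, y). x \<le> y}"

definition chain_sum :: "'a rel \<Rightarrow> 'b rel \<Rightarrow> ('a + 'b) rel"  (infixr "\<oplus>" 65) where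
  "A \<oplus> B = {(Inl a, Inl a') | a a'. (a, a') \<in> A}
         \<union> {(Inr b, Inr b') | b b'. (b, b') \<in> B}
         \<union> {(Inl a, Inr b) | a b. a \<in> Field A \<and> b \<in> Field B}"

definition chain_prod :: "'a rel \<Rightarrow> 'b rel \<Rightarrow> ('a \<times> 'b) rel"  (infixr "\<otimes>" 70) where
  "A \<otimes> B = {((a, b), (a', b')) | a b a' b'.
      a \<in> Field A \<and> a' \<in> Field A \<and> b \<in> Field B \<and> b' \<in> Field B \<and>
      (b \<noteq> b' \<and> (b, b') \<in> B \<or> b = b' \<and> (a, a') \<in> A)}"

definition tail :: "'a rel \<Rightarrow> 'a \<Rightarrow> 'a rel" where
  "tail A x = Restr A (above A x)"

definition uniform :: "'a rel \<Rightarrow> bool" where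
  "uniform A \<longleftrightarrow> Linear_order A \<and> (\<forall>x\<in>Field A. \<forall>y\<in>Field A. tail A x \<cong> tail A y)"

text \<open>The order type of the following chain does not depend on the choice when
  \<open>A\<close> is uniform and nonempty.\<close>

definition common_tail :: "'a rel \<Rightarrow> 'a rel" where
  "common_tail A = tail A (SOME x. x \<in> Field A)"

subsection \<open>Condensations and rank\<close>

definition quotient_chain :: "'a rel \<Rightarrow> 'a rel \<Rightarrow> 'a set rel" where
  "quotient_chain A E = {(X, Y). X \<in> Field A // E \<and> Y \<in> Field A // E \<and>
                                 (\<exists>x\<in>X. \<exists>y\<in>Y. (x, y) \<in> A)}"

definition interval :: "'a rel \<Rightarrow> 'a \<Rightarrow> 'a \<Rightarrow> 'a set" where
  "interval A x y = {z. (x, z) \<in> A \<and> (z, y) \<in> A \<or> (y, z) \<in> A \<and> (z, x) \<in> A}"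

definition condense :: "'a rel \<Rightarrow> 'a rel \<Rightarrow> 'a rel" where
  "condense A E = {(x, y). x \<in> Field A \<and> y \<in> Field A \<and>
                           finite (interval (quotient_chain A E) (E `` {x}) (E `` {y}))}"

text \<open>Every ordinal smaller than \<open>\<alpha>\<close> is, up to \<open>=o\<close>, of the form \<open>initial \<alpha> b\<close> with
  \<open>b \<in> Field \<alpha>\<close>. The ordinal \<open>\<alpha>\<close> is a successor iff it has a greatest element \<open>m\<close>, and
  its predecessor is then \<open>initial \<alpha> m\<close>.\<close>

definition initial :: "'b rel \<Rightarrow> 'b \<Rightarrow> 'b rel" where
  "initial \<alpha> b = Restr \<alpha> (underS \<alpha> b)"

definition greatest :: "'b rel \<Rightarrow> 'b \<Rightarrow> bool" where
  "greatest \<alpha> m \<longleftrightarrow> m \<in> Field \<alpha> \<and> (\<forall>b\<in>Field \<alpha>. (b, m) \<in> \<alpha>)"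

text \<open>The relation \<open>\<rho>\<^sub>\<alpha>\<close> of the chain \<open>A\<close>; the value for \<open>\<alpha>\<close> not a well-order is irrelevant.\<close>

function rho :: "'a rel \<Rightarrow> 'b rel \<Rightarrow> 'a rel" where
  "rho A \<alpha> =
    (if \<not> Well_order \<alpha> then {}
     else if Field \<alpha> = {} then Id_on (Field A)
     else if \<exists>m. greatest \<alpha> m then condense A (rho A (initial \<alpha> (THE m. greatest \<alpha> m)))
     else (\<Union>b\<in>Field \<alpha>. rho A (initial \<alpha> b)))"
  by pat_completeness auto
termination
proof (relation "inv_image ordLess snd")
  show "wf (inv_image ordLess (snd :: 'a rel \<times> 'b rel \<Rightarrow> 'b rel))"
    by (simp add: wf_ordLess)
qed (auto simp: initial_def intro: underS_Restr_ordLess)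

declare rho.simps [simp del]

text \<open>\<open>has_rank A \<alpha>\<close>: the rank of \<open>A\<close> is defined (so \<open>A\<close> is decomposable) and equals \<open>\<alpha>\<close>.
  The type of \<open>\<beta>\<close> is that of \<open>\<alpha>\<close>, which suffices to represent all ordinals below \<open>\<alpha>\<close>.\<close>

definition has_rank :: "'a rel \<Rightarrow> 'b rel \<Rightarrow> bool" where
  "has_rank A \<alpha> \<longleftrightarrow> Well_order \<alpha> \<and>
     quotient_chain A (rho A \<alpha>) \<cong> one_chain \<and>
     (\<forall>\<beta> :: 'b rel. \<beta> <o \<alpha> \<longrightarrow> \<not> quotient_chain A (rho A \<beta>) \<cong> one_chain)"

subsection \<open>Sequences and their trees\<close>

definition seqs :: "nat \<Rightarrow> nat list set" where
  "seqs m = {s. length s = m \<and> (\<forall>i<m. s ! i \<le> i)}"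

definition seq_minus :: "nat list \<Rightarrow> nat list" where
  "seq_minus s = butlast s"

definition seq_plus :: "nat list \<Rightarrow> nat list" where
  "seq_plus s = butlast (butlast s) @ [last s]"

fun children :: "nat list \<times> nat \<Rightarrow> (nat list \<times> nat) list" where
  "children (t, k) =
    (if length t < 2 then []
     else if last t = length t - 1 then [(seq_minus t, 0)]
     else [(seq_plus t, k + 1), (seq_minus t, 0)])"

text \<open>The leaves below a node, from left to right.\<close>

function leaves :: "nat list \<times> nat \<Rightarrow> (nat list \<times> nat) list" where
  "leaves v = (if children v = [] then [v] else concat (map leaves (children v)))"
  by pat_completeness auto
termination
  by (relation "measure (length \<circ> fst)") (auto simp: seq_minus_def seq_plus_def split: if_splits)

declare leaves.simps [simp del]

definition ell :: "nat list \<Rightarrow> nat" where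
  "ell s = length (leaves (s, 0))"

definition wt :: "nat list \<Rightarrow> nat \<Rightarrow> nat" where
  "wt s i = snd (leaves (s, 0) ! i)"

definition weights :: "nat list \<Rightarrow> nat set" where
  "weights s = wt s ` {..<ell s}"

subsection \<open>The chains built from a sequence\<close>

text \<open>The carrier type of \<open>\<A>(s)[M\<^sub>0, \<dots>]\<close> depends on \<open>s\<close>; the following type contains
  a copy of each of them, the constructors being the injections.\<close>

datatype 'a elt =
    Base 'a
  | InZ "'a elt \<times> int"
  | InN "'a elt + 'a elt \<times> nat"

function construct :: "nat list \<Rightarrow> 'a rel list \<Rightarrow> 'a elt rel" where
  "construct s Ms =
    (if length s < 2 then dir_image (Ms ! 0) Base
     else if last s = length s - 1 then
       dir_image (construct (seq_minus s) Ms \<otimes> int_chain) InZ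
     else
       dir_image (construct (seq_plus s) (take (ell (seq_plus s)) Ms) \<oplus>
                  construct (seq_minus s) (drop (ell (seq_plus s)) Ms) \<otimes> natLeq) InN)"
  by pat_completeness auto
termination
  by (relation "measure (length \<circ> fst)") (auto simp: seq_minus_def seq_plus_def)

declare construct.simps [simp del]

text \<open>\<open>\<A>(s){\<langle>U\<^sub>k, k\<rangle> : k \<in> W(s)}\<close>, where \<open>W(s)\<close> is \<open>weights s\<close>; only the values of \<open>U\<close> on \<open>weights s\<close> are used.\<close>

definition construct_from :: "nat list \<Rightarrow> (nat \<Rightarrow> 'a rel) \<Rightarrow> 'a elt rel" where
  "construct_from s U = construct s (map (\<lambda>i. U (wt s i)) [0..<ell s])"

definition admissible :: "nat list \<Rightarrow> (nat \<Rightarrow> 'a rel) \<Rightarrow> bool" where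
  "admissible s U \<longleftrightarrow>
     (\<forall>k\<in>weights s. uniform (U k) \<and> has_rank (U k) natLeq) \<and>
     (\<forall>k\<in>weights s. \<forall>l\<in>weights s. common_tail (U k) \<cong> common_tail (U l))"

end

theory Submission
  imports Defs
begin

text \<open>
  The theorem rests on one structural fact. A uniform chain of rank \<open>\<omega> + n + 1\<close> is a succession, indexed
  by \<open>\<int>\<close> or by \<open>\<nat>\<close>, of its components of level \<open>\<omega> + n\<close>. All of them, except a first one if there
  is one, are copies of a single uniform chain \<open>M\<close> of rank \<open>\<omega> + n\<close>, and a first component is uniform with
  the same tails as \<open>M\<close>. Such chains are called layered below.

  Indeed, the components are finitely many between any two elements, and they have no last one because then
  some tail would have smaller rank (\<open>uniform_layered\<close>); an isomorphism of tails carries components to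
  components (\<open>counts_tail_iso\<close>), which gives the statement on \<open>M\<close>. Conversely, every tail
  of a layered chain is a tail of \<open>M\<close> followed by \<open>\<omega>\<close> copies of \<open>M\<close>, so a layered chain is uniform and
  its tails depend on \<open>M\<close> only (\<open>layered_teq\<close>); and it has rank \<open>\<omega> + n + 1\<close>, because an element of one copy of
  \<open>M\<close> is never condensed with one of a later copy: a class of a level below the rank cannot be cofinal
  in a uniform chain (\<open>not_lev_above\<close>, \<open>layered_rank\<close>).

  This yields the first part by induction along the tree (\<open>node_chain_uniform\<close>): the chain of \<open>s\<close> is layered
  over the chain of \<open>s\<^sup>-\<close>, and the two chains in the sum for \<open>s\<close> have the same tails because
  both are layered over the same chain or, at rank \<open>\<omega>\<close>, by assumption. For the second part, let \<open>A\<close> be layered over \<open>M\<close>, where \<open>M\<close> is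
  the chain of \<open>r\<close> by induction. Either \<open>A \<cong> M \<int>\<close>, or \<open>A \<cong> M' + M \<nat>\<close> where \<open>M'\<close> has the tails of \<open>M\<close>. As
  the tails determine the repeated component (\<open>layered_unique\<close>), \<open>M'\<close> is layered over the same chain as
  \<open>M\<close>, so the same dichotomy applies to \<open>M'\<close>, and so on downwards. The new last entry of the sequence is \<open>j\<close> if
  the index set \<open>\<int>\<close> appears at a chain of rank \<open>\<omega> + j\<close>, and \<open>0\<close> if the descent reaches rank \<open>\<omega>\<close>
  (\<open>extend_seq\<close>).
\<close>

section \<open>Chains, isomorphisms and convex embeddings\<close>

lemma lin_refl: "Linear_order A \<Longrightarrow> x \<in> Field A \<Longrightarrow> (x, x) \<in> A"
  by (simp add: order_on_defs refl_on_def)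

lemma lin_trans: "Linear_order A \<Longrightarrow> (x, y) \<in> A \<Longrightarrow> (y, z) \<in> A \<Longrightarrow> (x, z) \<in> A"
  unfolding order_on_defs by (meson transD)

lemma lin_antisym: "Linear_order A \<Longrightarrow> (x, y) \<in> A \<Longrightarrow> (y, x) \<in> A \<Longrightarrow> x = y"
  unfolding order_on_defs by (meson antisymD)

lemma lin_total: "Linear_order A \<Longrightarrow> x \<in> Field A \<Longrightarrow> y \<in> Field A \<Longrightarrow> (x, y) \<in> A \<or> (y, x) \<in> A"
  by (cases "x = y") (auto simp: order_on_defs refl_on_def total_on_def)

lemma lin_Field: "(x, y) \<in> A \<Longrightarrow> x \<in> Field A \<and> y \<in> Field A"
  by (auto intro: FieldI1 FieldI2)

lemma lin_orderI:
  assumes "\<And>x. x \<in> Field A \<Longrightarrow> (x, x) \<in> A"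
    and "\<And>x y z. (x, y) \<in> A \<Longrightarrow> (y, z) \<in> A \<Longrightarrow> (x, z) \<in> A"
    and "\<And>x y. (x, y) \<in> A \<Longrightarrow> (y, x) \<in> A \<Longrightarrow> x = y"
    and "\<And>x y. x \<in> Field A \<Longrightarrow> y \<in> Field A \<Longrightarrow> (x, y) \<in> A \<or> (y, x) \<in> A"
  shows "Linear_order A"
  unfolding order_on_defs refl_on_def trans_def antisym_def total_on_def
  using assms by (auto intro: FieldI1 FieldI2)

lemma Field_Restr_lin: "Linear_order A \<Longrightarrow> Field (Restr A S) = Field A \<inter> S"
proof -
  assume L: "Linear_order A"
  have "x \<in> Field (Restr A S)" if "x \<in> Field A" "x \<in> S" for x
    using lin_refl[OF L that(1)] that(2) by (intro FieldI1[of x x]) auto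
  then show ?thesis by (auto simp: Field_def)
qed

lemma Linear_order_Restr': "Linear_order A \<Longrightarrow> Linear_order (Restr A S)"
  by (rule lin_orderI)
     (auto simp: Field_Restr_lin intro: lin_refl lin_trans lin_antisym dest: lin_total)

lemma lin_has_max:
  assumes "Linear_order A" "finite S" "S \<noteq> {}" "S \<subseteq> Field A"
  shows "\<exists>m\<in>S. \<forall>s\<in>S. (s, m) \<in> A"
  using assms(2,3,4)
proof (induction rule: finite_ne_induct)
  case (singleton x)
  then show ?case using lin_refl[OF assms(1)] by auto
next
  case (insert x S)
  then obtain m where m: "m \<in> S" "\<forall>s\<in>S. (s, m) \<in> A" by auto
  show ?case
  proof (cases "(x, m) \<in> A")
    case True
    then show ?thesis using m by auto
  next
    case False
    then have "(m, x) \<in> A" using lin_total[OF assms(1), of m x] insert.prems m by auto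
    then have "\<forall>s\<in>insert x S. (s, x) \<in> A"
      using m lin_trans[OF assms(1)] lin_refl[OF assms(1), of x] insert.prems by auto
    then show ?thesis by auto
  qed
qed

lemma chain_isoI:
  assumes "Linear_order A" "Linear_order B" "f ` Field A = Field B"
    and "\<And>x y. x \<in> Field A \<Longrightarrow> y \<in> Field A \<Longrightarrow> (x, y) \<in> A \<longleftrightarrow> (f x, f y) \<in> B"
  shows "A \<cong> B"
proof -
  have "inj_on f (Field A)"
  proof (rule inj_onI)
    fix x y assume "x \<in> Field A" "y \<in> Field A" "f x = f y"
    then show "x = y"
      using assms(4)[of x y] assms(4)[of y x] lin_refl[OF assms(2), of "f x"] assms(3)
        lin_antisym[OF assms(1), of x y] by auto
  qed
  then show ?thesis
    using assms(3,4) unfolding chain_iso_def iso_iff2 bij_betw_def by blast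
qed

lemma chain_isoE:
  assumes "A \<cong> B"
  obtains f where "inj_on f (Field A)" "f ` Field A = Field B"
    "\<And>x y. x \<in> Field A \<Longrightarrow> y \<in> Field A \<Longrightarrow> (x, y) \<in> A \<longleftrightarrow> (f x, f y) \<in> B"
proof -
  obtain f where "iso A B f" using assms unfolding chain_iso_def ..
  then have "inj_on f (Field A)" "f ` Field A = Field B"
    "\<forall>x\<in>Field A. \<forall>y\<in>Field A. (x, y) \<in> A \<longleftrightarrow> (f x, f y) \<in> B"
    unfolding iso_iff2 bij_betw_def by auto
  then show ?thesis by (intro that[of f]) blast+
qed

lemma chain_iso_refl [simp]: "A \<cong> A"
  unfolding chain_iso_def iso_iff2 by (rule exI[of _ id]) auto

lemma chain_iso_sym: assumes "A \<cong> B" shows "B \<cong> A"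
proof -
  obtain f where f: "inj_on f (Field A)" "f ` Field A = Field B"
    "\<And>x y. x \<in> Field A \<Longrightarrow> y \<in> Field A \<Longrightarrow> (x, y) \<in> A \<longleftrightarrow> (f x, f y) \<in> B"
    using assms by (rule chain_isoE) (rule that; simp)
  have "bij_betw (inv_into (Field A) f) (Field B) (Field A)"
    by (rule bij_betw_inv_into) (simp add: bij_betw_def f(1,2))
  moreover have "\<forall>a\<in>Field B. \<forall>b\<in>Field B.
      (a, b) \<in> B \<longleftrightarrow> (inv_into (Field A) f a, inv_into (Field A) f b) \<in> A"
  proof (intro ballI)
    fix a b assume "a \<in> Field B" "b \<in> Field B"
    then have "a \<in> f ` Field A" "b \<in> f ` Field A" using f by auto
    then show "(a, b) \<in> B \<longleftrightarrow> (inv_into (Field A) f a, inv_into (Field A) f b) \<in> A"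
      by (simp add: f(3) f_inv_into_f inv_into_into)
  qed
  ultimately show ?thesis unfolding chain_iso_def iso_iff2 by blast
qed

lemma chain_iso_trans: assumes "A \<cong> B" "B \<cong> C" shows "A \<cong> C"
proof -
  obtain f where f: "inj_on f (Field A)" "f ` Field A = Field B"
    "\<And>x y. x \<in> Field A \<Longrightarrow> y \<in> Field A \<Longrightarrow> (x, y) \<in> A \<longleftrightarrow> (f x, f y) \<in> B"
    using assms(1) by (rule chain_isoE) (rule that; simp)
  obtain g where g: "inj_on g (Field B)" "g ` Field B = Field C"
    "\<And>x y. x \<in> Field B \<Longrightarrow> y \<in> Field B \<Longrightarrow> (x, y) \<in> B \<longleftrightarrow> (g x, g y) \<in> C"
    using assms(2) by (rule chain_isoE) (rule that; simp)
  have "bij_betw (g \<circ> f) (Field A) (Field C)"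
    using f g bij_betw_trans unfolding bij_betw_def by (metis comp_inj_on image_comp)
  moreover have "(x, y) \<in> A \<longleftrightarrow> ((g \<circ> f) x, (g \<circ> f) y) \<in> C" if "x \<in> Field A" "y \<in> Field A" for x y
  proof -
    have "f x \<in> Field B" "f y \<in> Field B" using that f(2) by auto
    then show ?thesis using f(3)[OF that] g(3) by simp
  qed
  ultimately show ?thesis unfolding chain_iso_def iso_iff2 by blast
qed

lemma chain_iso_Field_empty: "A \<cong> B \<Longrightarrow> Field A = {} \<longleftrightarrow> Field B = {}"
  by (erule chain_isoE) auto

lemma Linear_order_iso: assumes "A \<cong> B" "Linear_order A" shows "Linear_order B"
proof -
  obtain f where f: "inj_on f (Field A)" "f ` Field A = Field B"
    "\<And>x y. x \<in> Field A \<Longrightarrow> y \<in> Field A \<Longrightarrow> (x, y) \<in> A \<longleftrightarrow> (f x, f y) \<in> B"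
    using assms(1) by (rule chain_isoE) (rule that; simp)
  have im: "\<exists>a. a \<in> Field A \<and> x = f a" if "x \<in> Field B" for x using that f(2) by auto
  note L = assms(2)
  show ?thesis
  proof (rule lin_orderI)
    fix x assume "x \<in> Field B"
    then show "(x, x) \<in> B" using im[of x] f(3) lin_refl[OF L] by auto
  next
    fix x y z assume *: "(x, y) \<in> B" "(y, z) \<in> B"
    then obtain a b c where "a \<in> Field A" "b \<in> Field A" "c \<in> Field A" "x = f a" "y = f b" "z = f c"
      using im lin_Field by metis
    then show "(x, z) \<in> B" using * f(3) lin_trans[OF L] by metis
  next
    fix x y assume *: "(x, y) \<in> B" "(y, x) \<in> B"
    then obtain a b where "a \<in> Field A" "b \<in> Field A" "x = f a" "y = f b"
      using im lin_Field by metis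
    then show "x = y" using * f(3) lin_antisym[OF L] by metis
  next
    fix x y assume "x \<in> Field B" "y \<in> Field B"
    then show "(x, y) \<in> B \<or> (y, x) \<in> B" using im f(3) lin_total[OF L] by metis
  qed
qed

text \<open>Embeddings of a chain onto a convex subset of another chain. Isomorphisms, inclusions
  of tails and inclusions of components are all of this kind, and each relation
  \<open>\<rho>\<^sub>\<alpha>\<close> of the smaller chain is the restriction of that of the larger one.\<close>

definition conv_emb :: "('a \<Rightarrow> 'b) \<Rightarrow> 'a rel \<Rightarrow> 'b rel \<Rightarrow> bool" where
  "conv_emb f B A \<longleftrightarrow> Linear_order B \<and> Linear_order A \<and> f ` Field B \<subseteq> Field A \<and>
     (\<forall>x\<in>Field B. \<forall>y\<in>Field B. (x, y) \<in> B \<longleftrightarrow> (f x, f y) \<in> A) \<and>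
     (\<forall>x\<in>Field B. \<forall>y\<in>Field B. \<forall>z. (f x, z) \<in> A \<longrightarrow> (z, f y) \<in> A \<longrightarrow> z \<in> f ` Field B)"

lemma conv_emb_iso:
  assumes "Linear_order A" "A \<cong> B" obtains f where "conv_emb f A B" "f ` Field A = Field B"
proof -
  obtain f where f: "f ` Field A = Field B"
    "\<And>x y. x \<in> Field A \<Longrightarrow> y \<in> Field A \<Longrightarrow> (x, y) \<in> A \<longleftrightarrow> (f x, f y) \<in> B"
    using assms(2) by (rule chain_isoE) (rule that; simp)
  have "conv_emb f A B"
    using f assms Linear_order_iso[OF assms(2,1)] unfolding conv_emb_def
    by (auto dest: lin_Field)
  then show ?thesis using that f by blast
qed

lemma conv_emb_Restr:
  assumes "Linear_order A"
    and "\<And>x y z. x \<in> S \<Longrightarrow> y \<in> S \<Longrightarrow> (x, z) \<in> A \<Longrightarrow> (z, y) \<in> A \<Longrightarrow> z \<in> S"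
  shows "conv_emb id (Restr A S) A"
  using assms Linear_order_Restr'[OF assms(1), of S] unfolding conv_emb_def
  by (auto simp: Field_Restr_lin[OF assms(1)] dest: lin_Field)


lemma Field_tail: "Linear_order A \<Longrightarrow> Field (tail A x) = {z. (x, z) \<in> A}"
  unfolding tail_def by (auto simp: Field_Restr_lin above_def dest: lin_Field)

lemma tail_iff: "(y, z) \<in> tail A x \<longleftrightarrow> (x, y) \<in> A \<and> (x, z) \<in> A \<and> (y, z) \<in> A"
  by (auto simp: tail_def above_def)

lemma Linear_order_tail: "Linear_order A \<Longrightarrow> Linear_order (tail A x)"
  unfolding tail_def by (rule Linear_order_Restr')

lemma conv_emb_tail: "Linear_order A \<Longrightarrow> conv_emb id (tail A x) A"
  unfolding tail_def by (rule conv_emb_Restr) (auto simp: above_def intro: lin_trans)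

text \<open>The isomorphism between two tails maps the least element to the least element.\<close>

lemma tail_isoE:
  assumes "Linear_order A" "Linear_order B" "tail A x \<cong> tail B y" "x \<in> Field A" "y \<in> Field B"
  obtains f where "conv_emb f (tail A x) B" "f ` {z. (x, z) \<in> A} = {z. (y, z) \<in> B}" "f x = y"
proof -
  obtain f where f: "conv_emb f (tail A x) (tail B y)" "f ` Field (tail A x) = Field (tail B y)"
    using conv_emb_iso[OF Linear_order_tail[OF assms(1)] assms(3)] by blast
  have im: "f ` {z. (x, z) \<in> A} = {z. (y, z) \<in> B}"
    using f(2) assms by (simp add: Field_tail)
  have iff: "(u, v) \<in> A \<longleftrightarrow> (f u, f v) \<in> B" if "(x, u) \<in> A" "(x, v) \<in> A" for u v
    using f that assms im unfolding conv_emb_def by (auto simp: Field_tail tail_iff)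
  have xx: "(x, x) \<in> A" "(y, y) \<in> B" using assms by (auto intro: lin_refl)
  have "f x = y"
  proof -
    have 1: "(y, f x) \<in> B" using im xx by auto
    obtain z where z: "(x, z) \<in> A" "f z = y" using im xx by (metis (mono_tags, lifting) imageE mem_Collect_eq)
    have "(f x, f z) \<in> B" using iff[of x z] z xx by auto
    then show ?thesis using 1 z lin_antisym[OF assms(2)] by auto
  qed
  moreover have "conv_emb f (tail A x) B"
    unfolding conv_emb_def
  proof (intro conjI ballI allI impI)
    show "Linear_order (tail A x)" "Linear_order B" using assms Linear_order_tail by auto
    show "f ` Field (tail A x) \<subseteq> Field B" using im assms by (auto simp: Field_tail dest: lin_Field)
    fix u v assume uv: "u \<in> Field (tail A x)" "v \<in> Field (tail A x)"
    then show "((u, v) \<in> tail A x) = ((f u, f v) \<in> B)"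
      using iff[of u v] assms by (auto simp: Field_tail tail_iff)
    fix z assume "(f u, z) \<in> B" "(z, f v) \<in> B"
    then have "(y, z) \<in> B" using uv im lin_trans[OF assms(2)] assms(1) by (auto simp: Field_tail)
    then show "z \<in> f ` Field (tail A x)" using im assms(1) by (auto simp: Field_tail)
  qed
  ultimately show ?thesis using that im by blast
qed

section \<open>Condensation\<close>

text \<open>The relation \<open>E\<close> is a convex equivalence relation on the chain \<open>A\<close>.\<close>

definition conveq :: "'a rel \<Rightarrow> 'a rel \<Rightarrow> bool" where
  "conveq A E \<longleftrightarrow> equiv (Field A) E \<and> (\<forall>x y z. (x, y) \<in> A \<longrightarrow> (y, z) \<in> A \<longrightarrow> (x, z) \<in> E \<longrightarrow> (x, y) \<in> E)"

lemma conveq_refl: "conveq A E \<Longrightarrow> x \<in> Field A \<Longrightarrow> (x, x) \<in> E"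
  unfolding conveq_def equiv_def refl_on_def by blast

lemma conveq_sym: "conveq A E \<Longrightarrow> (x, y) \<in> E \<Longrightarrow> (y, x) \<in> E"
  unfolding conveq_def equiv_def by (meson symD)

lemma conveq_trans: "conveq A E \<Longrightarrow> (x, y) \<in> E \<Longrightarrow> (y, z) \<in> E \<Longrightarrow> (x, z) \<in> E"
  unfolding conveq_def equiv_def by (meson transD)

lemma conveq_Field: "conveq A E \<Longrightarrow> (x, y) \<in> E \<Longrightarrow> x \<in> Field A \<and> y \<in> Field A"
  unfolding conveq_def equiv_def by blast

lemma conveq_convex: "conveq A E \<Longrightarrow> (x, y) \<in> A \<Longrightarrow> (y, z) \<in> A \<Longrightarrow> (x, z) \<in> E \<Longrightarrow> (x, y) \<in> E"
  unfolding conveq_def by blast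

lemma conveq_convex2: "conveq A E \<Longrightarrow> (x, y) \<in> A \<Longrightarrow> (y, z) \<in> A \<Longrightarrow> (x, z) \<in> E \<Longrightarrow> (y, z) \<in> E"
  by (meson conveq_convex conveq_sym conveq_trans)

lemma conveq_class_eq: "conveq A E \<Longrightarrow> x \<in> Field A \<Longrightarrow> y \<in> Field A \<Longrightarrow> E `` {x} = E `` {y} \<longleftrightarrow> (x, y) \<in> E"
  using eq_equiv_class_iff[of "Field A" E x y] unfolding conveq_def by auto

lemma conveqI:
  assumes "E \<subseteq> Field A \<times> Field A" "\<And>x. x \<in> Field A \<Longrightarrow> (x, x) \<in> E"
    "\<And>x y. (x, y) \<in> E \<Longrightarrow> (y, x) \<in> E" "\<And>x y z. (x, y) \<in> E \<Longrightarrow> (y, z) \<in> E \<Longrightarrow> (x, z) \<in> E"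
    "\<And>x y z. (x, y) \<in> A \<Longrightarrow> (y, z) \<in> A \<Longrightarrow> (x, z) \<in> E \<Longrightarrow> (x, y) \<in> E"
  shows "conveq A E"
  unfolding conveq_def equiv_def refl_on_def sym_def trans_def using assms by blast

lemma conveq_Id: "Linear_order A \<Longrightarrow> conveq A (Id_on (Field A))"
  by (rule conveqI) (auto dest: lin_Field dest: lin_antisym)

text \<open>The classes of \<open>E\<close> that meet \<open>S\<close>.\<close>

definition classes :: "'a rel \<Rightarrow> 'a set \<Rightarrow> 'a set set" where
  "classes E S = (\<lambda>z. E `` {z}) ` S"

lemma classes_mono: "S \<subseteq> T \<Longrightarrow> classes E S \<subseteq> classes E T"
  unfolding classes_def by auto

lemma classes_Un: "classes E (S \<union> T) = classes E S \<union> classes E T"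
  unfolding classes_def by auto

lemma interval_sym: "interval A x y = interval A y x"
  unfolding interval_def by auto

lemma interval_le: "Linear_order A \<Longrightarrow> (x, y) \<in> A \<Longrightarrow> interval A x y = {z. (x, z) \<in> A \<and> (z, y) \<in> A}"
  unfolding interval_def using lin_trans lin_antisym by fast

lemma interval_Field: "interval A x y \<subseteq> Field A"
  unfolding interval_def by (auto dest: lin_Field)

lemma interval_tri:
  assumes "Linear_order A" "x \<in> Field A" "y \<in> Field A" "z \<in> Field A"
  shows "interval A x z \<subseteq> interval A x y \<union> interval A y z"
proof
  fix u assume u: "u \<in> interval A x z"
  then have "u \<in> Field A" by (rule interval_Field[THEN subsetD])
  then show "u \<in> interval A x y \<union> interval A y z"
    using u lin_total[OF assms(1), of u y] assms unfolding interval_def by auto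
qed

lemma interval_ends: "Linear_order A \<Longrightarrow> x \<in> Field A \<Longrightarrow> y \<in> Field A \<Longrightarrow> x \<in> interval A x y \<and> y \<in> interval A x y"
  unfolding interval_def using lin_total[of A x y] lin_refl[of A] by auto

text \<open>The interval between two classes of the quotient consists of the classes that meet the
  interval between representatives.\<close>

lemma interval_quotient:
  assumes L: "Linear_order A" and E: "conveq A E" and x: "x \<in> Field A" and y: "y \<in> Field A"
  shows "interval (quotient_chain A E) (E `` {x}) (E `` {y}) = classes E (interval A x y)"
proof -
  have quot: "(E `` {u}, E `` {v}) \<in> quotient_chain A E \<longleftrightarrow> (u, v) \<in> A \<or> (u, v) \<in> E"
    if uv: "u \<in> Field A" "v \<in> Field A" for u v
  proof
    assume "(E `` {u}, E `` {v}) \<in> quotient_chain A E"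
    then obtain u' v' where *: "(u, u') \<in> E" "(v, v') \<in> E" "(u', v') \<in> A"
      unfolding quotient_chain_def by auto
    show "(u, v) \<in> A \<or> (u, v) \<in> E"
    proof (rule ccontr)
      assume neg: "\<not> ?thesis"
      then have vu: "(v, u) \<in> A" using lin_total[OF L uv] by auto
      have u': "u' \<in> Field A" "v' \<in> Field A" using * by (auto dest: lin_Field)
      show False
      proof (cases "(u', v) \<in> A")
        case True
        then have "(u', v) \<in> E" using conveq_convex[OF E _ vu] conveq_sym[OF E *(1)] by blast
        then show False using neg *(1) conveq_trans[OF E] by blast
      next
        case False
        then have "(v, u') \<in> A" using lin_total[OF L u'(1) uv(2)] by auto
        then have "(v, u') \<in> E" using conveq_convex[OF E _ *(3) *(2)] by blast
        then show False using neg *(1) conveq_trans[OF E] conveq_sym[OF E] by blast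
      qed
    qed
  next
    assume "(u, v) \<in> A \<or> (u, v) \<in> E"
    then have "\<exists>u'\<in>E `` {u}. \<exists>v'\<in>E `` {v}. (u', v') \<in> A"
      using conveq_refl[OF E] conveq_sym[OF E] lin_refl[OF L] uv by blast
    then show "(E `` {u}, E `` {v}) \<in> quotient_chain A E"
      unfolding quotient_chain_def using uv by (auto intro: quotientI)
  qed
  have key: "E `` {z} \<in> classes E (interval A x y)"
    if x: "x \<in> Field A" and y: "y \<in> Field A" and z: "z \<in> Field A"
      and xz: "(x, z) \<in> A \<or> (x, z) \<in> E" and zy: "(z, y) \<in> A \<or> (z, y) \<in> E" for x y z
  proof -
    consider "(x, z) \<in> E" | "(z, y) \<in> E" | "(x, z) \<in> A" "(z, y) \<in> A" using xz zy by auto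
    then show ?thesis
    proof cases
      case 1
      then have "E `` {z} = E `` {x}" using conveq_class_eq[OF E x z] by auto
      then show ?thesis using interval_ends[OF L x y] unfolding classes_def by auto
    next
      case 2
      then have "E `` {z} = E `` {y}" using conveq_class_eq[OF E z y] by auto
      then show ?thesis using interval_ends[OF L x y] unfolding classes_def by auto
    next
      case 3
      then show ?thesis unfolding classes_def interval_def by auto
    qed
  qed
  show ?thesis
  proof
    show "interval (quotient_chain A E) (E `` {x}) (E `` {y}) \<subseteq> classes E (interval A x y)"
    proof
      fix Z assume Z: "Z \<in> interval (quotient_chain A E) (E `` {x}) (E `` {y})"
      then have "Z \<in> Field A // E" unfolding interval_def quotient_chain_def by auto
      then obtain z where z: "z \<in> Field A" "Z = E `` {z}" by (auto elim: quotientE)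
      show "Z \<in> classes E (interval A x y)"
        using Z z(1) quot[OF x z(1)] quot[OF z(1) y] quot[OF y z(1)] quot[OF z(1) x]
          key[OF x y z(1)] key[OF y x z(1)]
        unfolding interval_def[of "quotient_chain A E"] z(2) interval_sym[of A y x] by auto
    qed
  next
    show "classes E (interval A x y) \<subseteq> interval (quotient_chain A E) (E `` {x}) (E `` {y})"
    proof
      fix Z assume "Z \<in> classes E (interval A x y)"
      then obtain z where z: "z \<in> interval A x y" "Z = E `` {z}" unfolding classes_def by auto
      then have zF: "z \<in> Field A" using interval_Field[THEN subsetD] by fast
      show "Z \<in> interval (quotient_chain A E) (E `` {x}) (E `` {y})"
        using z quot[OF x zF] quot[OF zF y] quot[OF y zF] quot[OF zF x]
        unfolding interval_def by auto
    qed
  qed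
qed

lemma condense_iff:
  assumes "Linear_order A" "conveq A E"
  shows "(x, y) \<in> condense A E \<longleftrightarrow> x \<in> Field A \<and> y \<in> Field A \<and> finite (classes E (interval A x y))"
  unfolding condense_def using interval_quotient[OF assms] by auto

lemma classes_single:
  assumes "conveq A E" "\<And>z. z \<in> S \<Longrightarrow> (x, z) \<in> E"
  shows "classes E S \<subseteq> {E `` {x}}"
proof -
  have "E `` {z} = E `` {x}" if "z \<in> S" for z
    using assms(2)[OF that] conveq_class_eq[OF assms(1), of z x] conveq_Field[OF assms(1)] conveq_sym[OF assms(1)] by metis
  then show ?thesis unfolding classes_def by auto
qed

lemma condense_extensive:
  assumes L: "Linear_order A" and E: "conveq A E" shows "E \<subseteq> condense A E"
proof (rule subrelI)
  fix x y assume xy: "(x, y) \<in> E"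
  have F: "x \<in> Field A" "y \<in> Field A" using conveq_Field[OF E xy] by auto
  have "(x, z) \<in> E" if z: "z \<in> interval A x y" for z
  proof -
    have "(x, z) \<in> A \<and> (z, y) \<in> A \<or> (y, z) \<in> A \<and> (z, x) \<in> A" using z unfolding interval_def by auto
    then show ?thesis
      using conveq_convex[OF E] conveq_convex2[OF E] conveq_sym[OF E] xy by blast
  qed
  then have "finite (classes E (interval A x y))"
    by (rule finite_subset[OF classes_single[OF E]]) auto
  then show "(x, y) \<in> condense A E" using condense_iff[OF L E] F by auto
qed

lemma conveq_condense:
  assumes L: "Linear_order A" and E: "conveq A E" shows "conveq A (condense A E)"
proof (rule conveqI)
  note iff = condense_iff[OF L E]
  show "condense A E \<subseteq> Field A \<times> Field A" unfolding condense_def by auto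
  show "(x, x) \<in> condense A E" if "x \<in> Field A" for x
    using condense_extensive[OF L E] conveq_refl[OF E that] by auto
  show "(y, x) \<in> condense A E" if "(x, y) \<in> condense A E" for x y
    using that by (simp add: iff interval_sym)
  show "(x, z) \<in> condense A E" if "(x, y) \<in> condense A E" "(y, z) \<in> condense A E" for x y z
  proof -
    have "classes E (interval A x z) \<subseteq> classes E (interval A x y) \<union> classes E (interval A y z)"
      using interval_tri[OF L, of x y z] that classes_mono unfolding classes_Un[symmetric] iff by blast
    then show ?thesis using that finite_subset unfolding iff by blast
  qed
  show "(x, y) \<in> condense A E" if "(x, y) \<in> A" "(y, z) \<in> A" "(x, z) \<in> condense A E" for x y z
  proof -
    have xz: "(x, z) \<in> A" using that lin_trans[OF L] by blast
    have "interval A x y \<subseteq> interval A x z"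
      unfolding interval_le[OF L that(1)] interval_le[OF L xz]
      using lin_trans[OF L _ that(2)] by auto
    then show ?thesis using that(3) classes_mono finite_subset lin_Field[OF that(1)] unfolding iff by metis
  qed
qed

lemma classes_coarser:
  assumes "conveq A E" "conveq A E'" "E \<subseteq> E'" "S \<subseteq> Field A" "finite (classes E S)"
  shows "finite (classes E' S)"
proof -
  have "E' `` {z} = E' `` (E `` {z})" if "z \<in> S" for z
    using assms conveq_refl[OF assms(1), of z] conveq_trans[OF assms(2)] that by blast
  then have "classes E' S = (\<lambda>C. E' `` C) ` classes E S"
    unfolding classes_def by (auto simp: image_iff)
  then show ?thesis using assms(5) by simp
qed

lemma condense_mono:
  assumes "Linear_order A" "conveq A E" "conveq A E'" "E \<subseteq> E'"
  shows "condense A E \<subseteq> condense A E'"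
  using condense_iff[OF assms(1,2)] condense_iff[OF assms(1,3)]
    classes_coarser[OF assms(2-4) interval_Field] by auto

text \<open>On the chain \<open>B\<close>, the relation \<open>E'\<close> is the inverse image of \<open>E\<close> under \<open>f\<close>.\<close>

definition pulls_back :: "('a \<Rightarrow> 'b) \<Rightarrow> 'a rel \<Rightarrow> 'a rel \<Rightarrow> 'b rel \<Rightarrow> bool" where
  "pulls_back f B E' E \<longleftrightarrow> (\<forall>x\<in>Field B. \<forall>y\<in>Field B. (x, y) \<in> E' \<longleftrightarrow> (f x, f y) \<in> E)"

lemma pulls_back_classes_bij:
  assumes E': "conveq B E'" and E: "conveq A E" and f: "f ` Field B \<subseteq> Field A"
    and pb: "pulls_back f B E' E" and S: "S \<subseteq> Field B"
  shows "\<exists>h. bij_betw h (classes E (f ` S)) (classes E' S)"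
proof -
  have 1: "E' `` {z} = {w \<in> Field B. f w \<in> E `` {f z}}" if "z \<in> S" for z
  proof -
    have z: "z \<in> Field B" using that S by auto
    have "(z, w) \<in> E' \<longleftrightarrow> w \<in> Field B \<and> (f z, f w) \<in> E" for w
      using pb z conveq_Field[OF E', of z w] unfolding pulls_back_def by blast
    then show ?thesis by auto
  qed
  have 2: "E `` {f z} = E `` (f ` (E' `` {z}))" if z: "z \<in> S" for z
  proof -
    have zB: "z \<in> Field B" using z S by auto
    have "(f z, u) \<in> E" if "(z, w) \<in> E'" "(f w, u) \<in> E" for w u
    proof -
      have "w \<in> Field B" using that conveq_Field[OF E'] by blast
      then have "(f z, f w) \<in> E" using pb zB that unfolding pulls_back_def by auto
      then show ?thesis using that conveq_trans[OF E] by blast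
    qed
    then show ?thesis using conveq_refl[OF E' zB] by blast
  qed
  define h where "h = (\<lambda>C. {w \<in> Field B. f w \<in> C})"
  define g where "g = (\<lambda>C. E `` (f ` C))"
  have hg: "h (E `` {f z}) = E' `` {z}" "g (E' `` {z}) = E `` {f z}" if "z \<in> S" for z
    using 1[OF that] 2[OF that] unfolding h_def g_def by auto
  have "bij_betw h (classes E (f ` S)) (classes E' S)"
    by (rule bij_betw_byWitness[where f' = g]) (auto simp: classes_def hg)
  then show ?thesis by blast
qed

lemma pulls_back_finite_classes:
  assumes "conveq B E'" "conveq A E" "f ` Field B \<subseteq> Field A" "pulls_back f B E' E" "S \<subseteq> Field B"
  shows "finite (classes E' S) \<longleftrightarrow> finite (classes E (f ` S))"
  using pulls_back_classes_bij[OF assms] bij_betw_finite by blast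

lemma pulls_back_card_classes:
  assumes "conveq B E'" "conveq A E" "f ` Field B \<subseteq> Field A" "pulls_back f B E' E" "S \<subseteq> Field B"
  shows "card (classes E' S) = card (classes E (f ` S))"
  using pulls_back_classes_bij[OF assms] bij_betw_same_card by metis

lemma conv_emb_interval:
  assumes "conv_emb f B A" "x \<in> Field B" "y \<in> Field B"
  shows "interval A (f x) (f y) = f ` interval B x y"
proof
  show "interval A (f x) (f y) \<subseteq> f ` interval B x y"
  proof
    fix z assume z: "z \<in> interval A (f x) (f y)"
    then have "z \<in> f ` Field B" using assms unfolding conv_emb_def interval_def by blast
    then obtain w where "w \<in> Field B" "z = f w" by auto
    then show "z \<in> f ` interval B x y" using z assms unfolding conv_emb_def interval_def by auto
  qed
  show "f ` interval B x y \<subseteq> interval A (f x) (f y)"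
  proof
    fix z assume "z \<in> f ` interval B x y"
    then obtain w where w: "w \<in> interval B x y" "z = f w" by auto
    then have "w \<in> Field B" using interval_Field[THEN subsetD] by fast
    then show "z \<in> interval A (f x) (f y)" using w assms unfolding conv_emb_def interval_def by auto
  qed
qed

lemma pulls_back_condense:
  assumes f: "conv_emb f B A" and E': "conveq B E'" and E: "conveq A E" and pb: "pulls_back f B E' E"
  shows "pulls_back f B (condense B E') (condense A E)"
proof -
  have L: "Linear_order B" "Linear_order A" and im: "f ` Field B \<subseteq> Field A"
    using f unfolding conv_emb_def by auto
  show ?thesis
    unfolding pulls_back_def condense_iff[OF L(1) E'] condense_iff[OF L(2) E]
    using im by (auto simp: conv_emb_interval[OF f] pulls_back_finite_classes[OF E' E im pb interval_Field])
qed

section \<open>The relations \<open>\<rho>\<^sub>\<alpha>\<close> for \<open>\<alpha> < \<omega> + \<omega>\<close>\<close>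

text \<open>The index \<open>Inl k\<close> stands for the ordinal \<open>k\<close> and \<open>Inr n\<close> for \<open>\<omega> + n\<close>. The following function
  gives the relation \<open>\<rho>\<close> for the ordinal with a given index.\<close>

fun lev :: "nat + nat \<Rightarrow> 'a rel \<Rightarrow> 'a rel" where
  "lev (Inl k) A = (condense A ^^ k) (Id_on (Field A))"
| "lev (Inr n) A = (condense A ^^ n) (\<Union>k. (condense A ^^ k) (Id_on (Field A)))"

text \<open>The order of the ordinals in terms of their indices.\<close>

fun before :: "nat + nat \<Rightarrow> nat + nat \<Rightarrow> bool" where
  "before (Inl k) (Inl l) \<longleftrightarrow> k < l"
| "before (Inl k) (Inr n) \<longleftrightarrow> True"
| "before (Inr m) (Inl k) \<longleftrightarrow> False"
| "before (Inr m) (Inr n) \<longleftrightarrow> m < n"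

lemma conveq_lev_Inl: "Linear_order A \<Longrightarrow> conveq A (lev (Inl k) A)"
  by (induction k) (auto simp: conveq_Id conveq_condense)

lemma lev_Inl_Suc: "lev (Inl (Suc k)) A = condense A (lev (Inl k) A)"
  by simp

lemma lev_Inr_Suc: "lev (Inr (Suc n)) A = condense A (lev (Inr n) A)"
  by simp

lemma lev_Inr_0: "lev (Inr 0) A = (\<Union>k. lev (Inl k) A)"
  by simp

declare lev.simps [simp del]

lemma lev_Inl_mono: "Linear_order A \<Longrightarrow> k \<le> l \<Longrightarrow> lev (Inl k) A \<subseteq> lev (Inl l) A"
  by (rule lift_Suc_mono_le[of "\<lambda>k. lev (Inl k) A"])
     (auto simp: lev_Inl_Suc dest: condense_extensive[OF _ conveq_lev_Inl, THEN subsetD])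

lemma conveq_lev_Inr_0: assumes L: "Linear_order A" shows "conveq A (lev (Inr 0) A)"
proof (rule conveqI)
  note c = conveq_lev_Inl[OF L]
  show "lev (Inr 0) A \<subseteq> Field A \<times> Field A"
    unfolding lev_Inr_0 using conveq_Field[OF c] by auto
  show "(x, x) \<in> lev (Inr 0) A" if "x \<in> Field A" for x
    unfolding lev_Inr_0 using conveq_refl[OF c that] by auto
  show "(y, x) \<in> lev (Inr 0) A" if "(x, y) \<in> lev (Inr 0) A" for x y
    using that unfolding lev_Inr_0 using conveq_sym[OF c] by auto
  show "(x, z) \<in> lev (Inr 0) A" if xyz: "(x, y) \<in> lev (Inr 0) A" "(y, z) \<in> lev (Inr 0) A" for x y z
  proof -
    obtain k l where kl: "(x, y) \<in> lev (Inl k) A" "(y, z) \<in> lev (Inl l) A"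
      using xyz unfolding lev_Inr_0 by blast
    then have "(x, y) \<in> lev (Inl (max k l)) A" "(y, z) \<in> lev (Inl (max k l)) A"
      using lev_Inl_mono[OF L, of k "max k l"] lev_Inl_mono[OF L, of l "max k l"] by auto
    then show ?thesis unfolding lev_Inr_0 using conveq_trans[OF c] by blast
  qed
  show "(x, y) \<in> lev (Inr 0) A" if "(x, y) \<in> A" "(y, z) \<in> A" "(x, z) \<in> lev (Inr 0) A" for x y z
    using that unfolding lev_Inr_0 using conveq_convex[OF c] by blast
qed

lemma conveq_lev: assumes L: "Linear_order A" shows "conveq A (lev a A)"
proof (cases a)
  case (Inl k)
  then show ?thesis using conveq_lev_Inl[OF L] by simp
next
  case (Inr n)
  have "conveq A (lev (Inr n) A)"
    by (induction n) (auto simp: conveq_lev_Inr_0[OF L] lev_Inr_Suc conveq_condense[OF L])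
  then show ?thesis using Inr by simp
qed

lemma lev_Inr_mono: "Linear_order A \<Longrightarrow> m \<le> n \<Longrightarrow> lev (Inr m) A \<subseteq> lev (Inr n) A"
  by (rule lift_Suc_mono_le[of "\<lambda>k. lev (Inr k) A"])
     (auto simp: lev_Inr_Suc dest: condense_extensive[OF _ conveq_lev, THEN subsetD])

lemma lev_mono: assumes L: "Linear_order A" and "before a b" shows "lev a A \<subseteq> lev b A"
proof (cases a)
  case (Inl k)
  show ?thesis
  proof (cases b)
    case (Inl l) then show ?thesis using lev_Inl_mono[OF L, of k l] assms \<open>a = Inl k\<close> by simp
  next
    case (Inr n)
    then show ?thesis using lev_Inr_mono[OF L, of 0 n] \<open>a = Inl k\<close> unfolding lev_Inr_0 by blast
  qed
next
  case (Inr m)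
  then obtain n where "b = Inr n" "m < n" using assms by (cases b) auto
  then show ?thesis using lev_Inr_mono[OF L, of m n] Inr by simp
qed

lemma condense_lev_before:
  assumes L: "Linear_order A" and "before a (Inr n)" shows "condense A (lev a A) \<subseteq> lev (Inr n) A"
proof (cases a)
  case (Inl k)
  then show ?thesis using lev_mono[OF L, of "Inl (Suc k)" "Inr n"] by (simp add: lev_Inl_Suc)
next
  case (Inr m)
  then show ?thesis using lev_Inr_mono[OF L, of "Suc m" n] assms by (simp add: lev_Inr_Suc)
qed

lemma pulls_back_lev:
  assumes f: "conv_emb f B A" shows "pulls_back f B (lev a B) (lev a A)"
proof -
  have L: "Linear_order B" "Linear_order A" and im: "f ` Field B \<subseteq> Field A"
    and iff: "\<forall>x\<in>Field B. \<forall>y\<in>Field B. (x, y) \<in> B \<longleftrightarrow> (f x, f y) \<in> A"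
    using f unfolding conv_emb_def by auto
  have fin: "pulls_back f B (lev (Inl k) B) (lev (Inl k) A)" for k
  proof (induction k)
    case 0
    have "x = y" if "x \<in> Field B" "y \<in> Field B" "f x = f y" for x y
      using that iff lin_refl[OF L(1)] lin_antisym[OF L(1)] by metis
    then show ?case using im unfolding pulls_back_def lev.simps by auto
  next
    case (Suc k)
    then show ?case
      unfolding lev_Inl_Suc by (rule pulls_back_condense[OF f conveq_lev[OF L(1)] conveq_lev[OF L(2)]])
  qed
  show ?thesis
  proof (cases a)
    case (Inl k) then show ?thesis using fin by simp
  next
    case (Inr n)
    have "pulls_back f B (lev (Inr n) B) (lev (Inr n) A)"
    proof (induction n)
      case 0
      then show ?case using fin unfolding pulls_back_def lev_Inr_0 by auto
    next
      case (Suc k)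
      then show ?case
        unfolding lev_Inr_Suc by (rule pulls_back_condense[OF f conveq_lev[OF L(1)] conveq_lev[OF L(2)]])
    qed
    then show ?thesis using Inr by simp
  qed
qed

lemma lev_conv_emb:
  "conv_emb f B A \<Longrightarrow> x \<in> Field B \<Longrightarrow> y \<in> Field B \<Longrightarrow> (x, y) \<in> lev a B \<longleftrightarrow> (f x, f y) \<in> lev a A"
  using pulls_back_lev unfolding pulls_back_def by blast

text \<open>All elements of \<open>A\<close> are related, that is, the quotient of \<open>A\<close> has at most one element.\<close>

definition full :: "'a rel \<Rightarrow> 'a rel \<Rightarrow> bool" where
  "full A E \<longleftrightarrow> (\<forall>x\<in>Field A. \<forall>y\<in>Field A. (x, y) \<in> E)"

text \<open>The rank of \<open>A\<close> is the ordinal with index \<open>a\<close>.\<close>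

definition rank_is :: "'a rel \<Rightarrow> nat + nat \<Rightarrow> bool" where
  "rank_is A a \<longleftrightarrow> Field A \<noteq> {} \<and> full A (lev a A) \<and> (\<forall>b. before b a \<longrightarrow> \<not> full A (lev b A))"

lemma full_mono: "full A E \<Longrightarrow> E \<subseteq> E' \<Longrightarrow> full A E'"
  unfolding full_def by blast

lemma rank_is_Suc:
  assumes L: "Linear_order A"
  shows "rank_is A (Inr (Suc n)) \<longleftrightarrow>
    Field A \<noteq> {} \<and> full A (lev (Inr (Suc n)) A) \<and> \<not> full A (lev (Inr n) A)"
proof -
  have "lev b A \<subseteq> lev (Inr n) A" if "before b (Inr (Suc n))" for b
  proof (cases "b = Inr n")
    case False
    then have "before b (Inr n)" using that by (cases b) auto
    then show ?thesis using lev_mono[OF L] by blast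
  qed simp
  then show ?thesis unfolding rank_is_def using full_mono[of A] by (metis before.simps(4) lessI)
qed

section \<open>Uniform chains and tail equivalence\<close>

text \<open>All tails of \<open>A\<close> are isomorphic to all tails of \<open>B\<close>. Being uniform is tail equivalence to
  oneself; the empty chain is tail equivalent to every chain, which is why transitivity needs a
  nonempty chain in the middle.\<close>

definition teq :: "'a rel \<Rightarrow> 'b rel \<Rightarrow> bool" where
  "teq A B \<longleftrightarrow> (\<forall>x\<in>Field A. \<forall>y\<in>Field B. tail A x \<cong> tail B y)"

lemma uniform_teq: "uniform A \<longleftrightarrow> Linear_order A \<and> teq A A"
  unfolding uniform_def teq_def by blast

lemma teq_sym: "teq A B \<Longrightarrow> teq B A"
  unfolding teq_def using chain_iso_sym by blast

lemma teq_trans: "teq A B \<Longrightarrow> teq B C \<Longrightarrow> Field B \<noteq> {} \<Longrightarrow> teq A C"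
  unfolding teq_def by (meson chain_iso_trans ex_in_conv)

lemma uniform_if_teq: "Linear_order A \<Longrightarrow> teq A B \<Longrightarrow> Field B \<noteq> {} \<Longrightarrow> uniform A"
  unfolding uniform_teq using teq_trans teq_sym by blast

lemma uniform_Linear: "uniform A \<Longrightarrow> Linear_order A"
  unfolding uniform_def by blast

lemma tail_iso_if_iso:
  assumes "A \<cong> B" "Linear_order A" "x \<in> Field A" shows "\<exists>y\<in>Field B. tail A x \<cong> tail B y"
proof -
  obtain f where f: "f ` Field A = Field B"
    "\<And>x y. x \<in> Field A \<Longrightarrow> y \<in> Field A \<Longrightarrow> (x, y) \<in> A \<longleftrightarrow> (f x, f y) \<in> B"
    using assms(1) by (rule chain_isoE) (rule that; simp)
  have L: "Linear_order B" using assms Linear_order_iso by blast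
  have "tail A x \<cong> tail B (f x)"
  proof (rule chain_isoI[of _ _ f])
    show "Linear_order (tail A x)" by (rule Linear_order_tail[OF assms(2)])
    show "Linear_order (tail B (f x))" by (rule Linear_order_tail[OF L])
    show "f ` Field (tail A x) = Field (tail B (f x))"
    proof
      show "f ` Field (tail A x) \<subseteq> Field (tail B (f x))"
      proof
        fix w assume "w \<in> f ` Field (tail A x)"
        then obtain z where z: "(x, z) \<in> A" "w = f z" unfolding Field_tail[OF assms(2)] by auto
        then have "(f x, f z) \<in> B" using f(2)[OF assms(3), of z] lin_Field[OF z(1)] by simp
        then show "w \<in> Field (tail B (f x))" using z(2) unfolding Field_tail[OF L] by simp
      qed
      show "Field (tail B (f x)) \<subseteq> f ` Field (tail A x)"
      proof
        fix z assume z: "z \<in> Field (tail B (f x))"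
        then have "(f x, z) \<in> B" using Field_tail[OF L] by auto
        then obtain w where w: "w \<in> Field A" "z = f w" using f(1) lin_Field by (metis imageE)
        then have "(x, w) \<in> A" using f(2)[OF assms(3) w(1)] \<open>(f x, z) \<in> B\<close> by simp
        then show "z \<in> f ` Field (tail A x)" using w Field_tail[OF assms(2)] by auto
      qed
    qed
    fix u v assume "u \<in> Field (tail A x)" "v \<in> Field (tail A x)"
    then have uv: "(x, u) \<in> A" "(x, v) \<in> A" using Field_tail[OF assms(2)] by auto
    then have F: "u \<in> Field A" "v \<in> Field A" using lin_Field by metis+
    show "(u, v) \<in> tail A x \<longleftrightarrow> (f u, f v) \<in> tail B (f x)"
      using f(2)[OF F] f(2)[OF assms(3) F(1)] f(2)[OF assms(3) F(2)] uv by (simp add: tail_iff)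
  qed
  then show ?thesis using f(1) assms(3) by blast
qed

lemma teq_iso:
  assumes "A \<cong> B" "uniform A" shows "teq A B"
proof -
  have "tail A x \<cong> tail B y" if xy: "x \<in> Field A" "y \<in> Field B" for x y
  proof -
    have "B \<cong> A" "Linear_order B" using assms chain_iso_sym Linear_order_iso uniform_Linear by blast+
    then obtain z where "z \<in> Field A" "tail B y \<cong> tail A z"
      using tail_iso_if_iso[of B A y] xy by blast
    moreover have "tail A x \<cong> tail A z" using assms(2) xy \<open>z \<in> Field A\<close> unfolding uniform_def by blast
    ultimately show ?thesis using chain_iso_sym chain_iso_trans by blast
  qed
  then show ?thesis unfolding teq_def by blast
qed

lemma uniform_iso: assumes "A \<cong> B" "uniform A" shows "uniform B"
proof (cases "Field A = {}")
  case True
  then show ?thesis using chain_iso_Field_empty[OF assms(1)] Linear_order_iso[OF assms(1)] assms(2)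
    unfolding uniform_def by simp
next
  case False
  then show ?thesis
    using uniform_if_teq[of B A] teq_sym[OF teq_iso[OF assms]] Linear_order_iso[OF assms(1)] assms(2)
    unfolding uniform_def by blast
qed

text \<open>If one tail of \<open>A\<close> lies in a single \<open>\<rho>\<close>-class and all tails of \<open>B\<close> are isomorphic to it, then
  \<open>B\<close> consists of a single class, since any two elements of \<open>B\<close> lie in a common tail.\<close>

lemma tail_full:
  assumes LA: "Linear_order A" and LB: "Linear_order B" and t: "teq A B" and x: "x \<in> Field A"
    and all: "\<And>z. (x, z) \<in> A \<Longrightarrow> (x, z) \<in> lev a A"
  shows "full B (lev a B)"
proof -
  have *: "(u, v) \<in> lev a B" if uv: "(u, v) \<in> B" for u v
  proof -
    have F: "u \<in> Field B" using uv by (auto dest: lin_Field)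
    obtain f where f: "conv_emb f (tail A x) B" "f ` {z. (x, z) \<in> A} = {z. (u, z) \<in> B}" "f x = u"
      using tail_isoE[OF LA LB _ x F] t x F unfolding teq_def by metis
    obtain z where z: "(x, z) \<in> A" "f z = v" using f(2) uv by (metis (mono_tags, lifting) imageE mem_Collect_eq)
    have xz: "x \<in> Field (tail A x)" "z \<in> Field (tail A x)"
      using z lin_refl[OF LA x] Field_tail[OF LA] by auto
    have "(x, z) \<in> lev a (tail A x)"
      using lev_conv_emb[OF conv_emb_tail[OF LA] xz] all[OF z(1)] by simp
    then show ?thesis using lev_conv_emb[OF f(1) xz] f z by simp
  qed
  then show ?thesis
    unfolding full_def using lin_total[OF LB] conveq_sym[OF conveq_lev[OF LB]] by blast
qed

lemma full_teq:
  assumes "Linear_order A" "Linear_order B" "teq A B" "Field A \<noteq> {}" "full A (lev a A)"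
  shows "full B (lev a B)"
proof -
  obtain x where x: "x \<in> Field A" using assms(4) by blast
  have "(x, z) \<in> lev a A" if "(x, z) \<in> A" for z
    using assms(5) lin_Field[OF that] unfolding full_def by blast
  then show ?thesis by (rule tail_full[OF assms(1-3) x])
qed

lemma rank_is_teq:
  assumes "Linear_order A" "Linear_order B" "teq A B" "Field B \<noteq> {}" "rank_is A a"
  shows "rank_is B a"
  using assms(4,5) full_teq[OF assms(1-3)] full_teq[OF assms(2,1) teq_sym[OF assms(3)]]
  unfolding rank_is_def by blast

lemma rank_is_iso:
  assumes "A \<cong> B" "uniform A" "rank_is A a" shows "rank_is B a"
  using rank_is_teq[OF _ _ teq_iso[OF assms(1,2)] _ assms(3)] Linear_order_iso[OF assms(1)]
    chain_iso_Field_empty[OF assms(1)] assms(2,3) unfolding uniform_def rank_is_def by blast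

text \<open>In a uniform chain \<open>M\<close> of rank \<open>\<omega> + n\<close> no class of a lower level is cofinal, hence \<open>M\<close> cannot
  be condensed, in a larger chain, with anything above it.\<close>

lemma not_lev_above:
  assumes M: "uniform M" "rank_is M (Inr n)" and f: "conv_emb f M A" and x: "x \<in> Field M"
    and b: "\<And>y. y \<in> Field M \<Longrightarrow> (f y, b) \<in> A"
  shows "(f x, b) \<notin> lev (Inr n) A"
proof
  assume xb: "(f x, b) \<in> lev (Inr n) A"
  have LM: "Linear_order M" and LA: "Linear_order A" and t: "teq M M"
    using f M unfolding conv_emb_def uniform_teq by auto
  have mono: "(f u, f v) \<in> A" if "(u, v) \<in> M" for u v
    using that f lin_Field[OF that] unfolding conv_emb_def by blast
  have F: "u \<in> Field M" "v \<in> Field M" if "(u, v) \<in> M" for u v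
    using lin_Field that by metis+
  show False
  proof (cases n)
    case 0
    then obtain k where k: "(f x, b) \<in> lev (Inl k) A" using xb unfolding 0 lev_Inr_0 by auto
    have "(x, y) \<in> lev (Inl k) M" if y: "(x, y) \<in> M" for y
      using conveq_convex[OF conveq_lev[OF LA] mono[OF y] b[OF F(2)[OF y]] k]
        lev_conv_emb[OF f F[OF y]] by simp
    then have "full M (lev (Inl k) M)" by (rule tail_full[OF LM LM t x])
    then show False using M(2) unfolding rank_is_def by (metis before.simps(2))
  next
    case (Suc m)
    define E where "E = lev (Inr m) A"
    have E: "conveq A E" unfolding E_def by (rule conveq_lev[OF LA])
    have fin: "finite (classes E (interval A (f x) b))"
      using xb condense_iff[OF LA E] unfolding Suc lev_Inr_Suc E_def by auto
    \<comment> \<open>Finitely many classes meet the tail at \<open>x\<close>; beyond the largest of their representatives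
      there is only one class left.\<close>
    define Y where "Y = {y. (x, y) \<in> M}"
    have "f ` Y \<subseteq> interval A (f x) b"
      unfolding interval_le[OF LA b[OF x]] Y_def using mono b F by auto
    then have "classes E (f ` Y) \<subseteq> classes E (interval A (f x) b)" by (rule classes_mono)
    then have "finite ((\<lambda>y. E `` {f y}) ` Y)"
      using fin finite_subset unfolding classes_def image_image by blast
    then obtain Y0 where Y0: "Y0 \<subseteq> Y" "finite Y0" "(\<lambda>y. E `` {f y}) ` Y = (\<lambda>y. E `` {f y}) ` Y0"
      using finite_subset_image[of "(\<lambda>y. E `` {f y}) ` Y" "\<lambda>y. E `` {f y}" Y] by auto
    have "x \<in> Y" unfolding Y_def using lin_refl[OF LM x] by simp
    then have "Y0 \<noteq> {}" using Y0(3) by auto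
    moreover have "Y0 \<subseteq> Field M" using Y0(1) F unfolding Y_def by auto
    ultimately obtain u where u: "u \<in> Y0" "\<forall>y\<in>Y0. (y, u) \<in> M"
      using lin_has_max[OF LM Y0(2)] by blast
    have xu: "(x, u) \<in> M" using u Y0 unfolding Y_def by auto
    have "(u, y) \<in> lev (Inr m) M" if y: "(u, y) \<in> M" for y
    proof -
      have "y \<in> Y" using lin_trans[OF LM xu y] unfolding Y_def by simp
      then obtain v where v: "v \<in> Y0" "E `` {f y} = E `` {f v}" using Y0(3) by blast
      have vu: "(v, u) \<in> M" using u v by auto
      have "(f v, f y) \<in> E"
        using conveq_class_eq[OF E, of "f y" "f v"] v(2) conveq_sym[OF E] lin_Field[OF mono[OF vu]]
          lin_Field[OF mono[OF y]] by blast
      then have "(f u, f y) \<in> E" using conveq_convex2[OF E mono[OF vu] mono[OF y]] by blast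
      then show ?thesis using lev_conv_emb[OF f F[OF y]] unfolding E_def by simp
    qed
    then have "full M (lev (Inr m) M)" by (rule tail_full[OF LM LM t F(2)[OF xu]])
    then show False using M(2) unfolding Suc rank_is_Suc[OF LM] by simp
  qed
qed

section \<open>Layered chains\<close>

text \<open>The subchain on which \<open>d\<close> takes the value \<open>i\<close>.\<close>

definition fiber :: "'a rel \<Rightarrow> ('a \<Rightarrow> int) \<Rightarrow> int \<Rightarrow> 'a rel" where
  "fiber A d i = Restr A {z. d z = i}"

text \<open>The map \<open>d\<close> is weakly increasing on the chain \<open>A\<close>.\<close>

definition isotone :: "'a rel \<Rightarrow> ('a \<Rightarrow> int) \<Rightarrow> bool" where
  "isotone A d \<longleftrightarrow> (\<forall>x y. (x, y) \<in> A \<longrightarrow> d x \<le> d y)"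

lemma isotoneD: "isotone A d \<Longrightarrow> (x, y) \<in> A \<Longrightarrow> d x \<le> d y"
  unfolding isotone_def by blast

lemma isotone_less:
  "Linear_order A \<Longrightarrow> isotone A d \<Longrightarrow> x \<in> Field A \<Longrightarrow> y \<in> Field A \<Longrightarrow> d x < d y \<Longrightarrow> (x, y) \<in> A"
  using lin_total[of A x y] isotoneD[of A d y x] by fastforce

lemma fiber_iff: "(x, y) \<in> fiber A d i \<longleftrightarrow> (x, y) \<in> A \<and> d x = i \<and> d y = i"
  unfolding fiber_def by auto

lemma Field_fiber: "Linear_order A \<Longrightarrow> Field (fiber A d i) = {x \<in> Field A. d x = i}"
  unfolding fiber_def by (auto simp: Field_Restr_lin)

lemma Linear_order_fiber: "Linear_order A \<Longrightarrow> Linear_order (fiber A d i)"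
  unfolding fiber_def by (rule Linear_order_Restr')

lemma conv_emb_fiber:
  assumes "Linear_order A" "isotone A d" shows "conv_emb id (fiber A d i) A"
  unfolding fiber_def
proof (rule conv_emb_Restr[OF assms(1)])
  fix x y z assume *: "x \<in> {z. d z = i}" "y \<in> {z. d z = i}" "(x, z) \<in> A" "(z, y) \<in> A"
  then show "z \<in> {z. d z = i}"
    using isotoneD[OF assms(2) *(3)] isotoneD[OF assms(2) *(4)] by simp
qed

text \<open>Chains with isotone maps onto the same set of integers are isomorphic if
  corresponding fibers are.\<close>

lemma glue_fibers:
  assumes LA: "Linear_order A" and LB: "Linear_order B" and d: "isotone A d" and e: "isotone B e"
    and im: "d ` Field A = e ` Field B"
    and iso: "\<And>i. i \<in> d ` Field A \<Longrightarrow> fiber A d i \<cong> fiber B e i"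
  shows "A \<cong> B"
proof -
  have "\<exists>f. f ` {x \<in> Field A. d x = i} = {x \<in> Field B. e x = i} \<and>
      (\<forall>x y. x \<in> Field A \<longrightarrow> y \<in> Field A \<longrightarrow> d x = i \<longrightarrow> d y = i \<longrightarrow> (x, y) \<in> A \<longleftrightarrow> (f x, f y) \<in> B)"
    if i: "i \<in> d ` Field A" for i
  proof -
    obtain f where f: "f ` Field (fiber A d i) = Field (fiber B e i)"
      "\<And>x y. x \<in> Field (fiber A d i) \<Longrightarrow> y \<in> Field (fiber A d i) \<Longrightarrow>
        (x, y) \<in> fiber A d i \<longleftrightarrow> (f x, f y) \<in> fiber B e i"
      using iso[OF i] by (rule chain_isoE) (rule that; simp)
    have 1: "f ` {x \<in> Field A. d x = i} = {x \<in> Field B. e x = i}"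
      using f(1) unfolding Field_fiber[OF LA] Field_fiber[OF LB] .
    have "(x, y) \<in> A \<longleftrightarrow> (f x, f y) \<in> B" if xy: "x \<in> Field A" "y \<in> Field A" "d x = i" "d y = i" for x y
    proof -
      have "f x \<in> {x \<in> Field B. e x = i}" "f y \<in> {x \<in> Field B. e x = i}" using 1 xy by blast+
      then show ?thesis using f(2)[of x y] xy unfolding Field_fiber[OF LA] fiber_iff by simp
    qed
    then show ?thesis using 1 by blast
  qed
  then have "\<forall>i\<in>d ` Field A. \<exists>f. f ` {x \<in> Field A. d x = i} = {x \<in> Field B. e x = i} \<and>
      (\<forall>x y. x \<in> Field A \<longrightarrow> y \<in> Field A \<longrightarrow> d x = i \<longrightarrow> d y = i \<longrightarrow> (x, y) \<in> A \<longleftrightarrow> (f x, f y) \<in> B)"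
    by blast
  from bchoice[OF this] obtain f where
    f0: "\<forall>i\<in>d ` Field A. f i ` {x \<in> Field A. d x = i} = {x \<in> Field B. e x = i} \<and>
      (\<forall>x y. x \<in> Field A \<longrightarrow> y \<in> Field A \<longrightarrow> d x = i \<longrightarrow> d y = i \<longrightarrow> (x, y) \<in> A \<longleftrightarrow> (f i x, f i y) \<in> B)"
    ..
  have f: "f i ` {x \<in> Field A. d x = i} = {x \<in> Field B. e x = i}"
    "x \<in> Field A \<Longrightarrow> y \<in> Field A \<Longrightarrow> d x = i \<Longrightarrow> d y = i \<Longrightarrow>
       (x, y) \<in> A \<longleftrightarrow> (f i x, f i y) \<in> B" if "i \<in> d ` Field A" for i x y
    using f0 that by blast+
  define g where "g x = f (d x) x" for x
  have g: "g x \<in> Field B \<and> e (g x) = d x" if "x \<in> Field A" for x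
    using f(1)[of "d x"] that unfolding g_def by auto
  show ?thesis
  proof (rule chain_isoI[OF LA LB, of g])
    show "g ` Field A = Field B"
    proof
      show "g ` Field A \<subseteq> Field B" using g by auto
      show "Field B \<subseteq> g ` Field A"
      proof
        fix y assume y: "y \<in> Field B"
        then have i: "e y \<in> d ` Field A" using im by auto
        then have "y \<in> f (e y) ` {x \<in> Field A. d x = e y}" using f(1)[OF i] y by auto
        then obtain x where "x \<in> Field A" "d x = e y" "y = f (e y) x" by auto
        then show "y \<in> g ` Field A" unfolding g_def by (intro image_eqI[of _ _ x]) auto
      qed
    qed
    fix x y assume xy: "x \<in> Field A" "y \<in> Field A"
    consider "d x = d y" | "d x < d y" | "d y < d x" by linarith
    then show "(x, y) \<in> A \<longleftrightarrow> (g x, g y) \<in> B"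
    proof cases
      case 1
      then have "g y = f (d x) y" unfolding g_def by simp
      moreover have "(x, y) \<in> A \<longleftrightarrow> (f (d x) x, f (d x) y) \<in> B"
        by (rule f(2)) (use 1 xy in auto)
      ultimately show ?thesis unfolding g_def[of x] by simp
    next
      case 2
      then show ?thesis using isotone_less[OF LA d xy] isotone_less[OF LB e, of "g x" "g y"] g xy by simp
    next
      case 3
      then show ?thesis using isotoneD[OF d, of x y] isotoneD[OF e, of "g x" "g y"] g xy by force
    qed
  qed
qed

text \<open>The shape of a uniform chain of successor rank: copies of one uniform chain \<open>M\<close>, indexed by
  \<open>\<int>\<close> or by \<open>\<nat>\<close>; in the second case the first component need only have the
  tails of \<open>M\<close>. The chain is given together with the map \<open>d\<close> to the index set \<open>I\<close>.\<close>

definition layered :: "'a rel \<Rightarrow> ('a \<Rightarrow> int) \<Rightarrow> int set \<Rightarrow> 'b rel \<Rightarrow> bool" where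
  "layered A d I M \<longleftrightarrow> Linear_order A \<and> isotone A d \<and> d ` Field A = I \<and> (I = UNIV \<or> I = {0..}) \<and>
     uniform M \<and> Field M \<noteq> {} \<and> (\<forall>i\<in>I. teq (fiber A d i) M) \<and>
     (\<forall>i\<in>I. i - 1 \<in> I \<longrightarrow> fiber A d i \<cong> M)"

text \<open>A tail of a layered chain is a tail of \<open>M\<close> followed by \<open>\<omega>\<close> copies of \<open>M\<close>, whatever the index set
  and the first component are.\<close>

lemma layered_teq:
  assumes A: "layered A d I M" and B: "layered B e J N" and MN: "M \<cong> N"
  shows "teq A B"
proof -
  have LA: "Linear_order A" "isotone A d" "d ` Field A = I" "I = UNIV \<or> I = {0..}" "uniform M" "Field M \<noteq> {}"
    using A unfolding layered_def by auto
  have LB: "Linear_order B" "isotone B e" "e ` Field B = J" "J = UNIV \<or> J = {0..}" "uniform N" "Field N \<noteq> {}"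
    using B unfolding layered_def by auto
  have tailF: "fiber (tail C x) (\<lambda>z. c z - c x) i = (if i = 0 then tail (fiber C c (c x)) x else fiber C c (c x + i))"
    if C: "Linear_order C" "isotone C c" "x \<in> Field C" "0 \<le> i" for C :: "'x rel" and c x i
  proof -
    have "(x, u) \<in> C" if "u \<in> Field C" "c u = c x + i" "i \<noteq> 0" for u
      using isotone_less[OF C(1,2,3) that(1)] that(2,3) C(4) by simp
    then have "(u, v) \<in> fiber (tail C x) (\<lambda>z. c z - c x) i \<longleftrightarrow>
       (u, v) \<in> (if i = 0 then tail (fiber C c (c x)) x else fiber C c (c x + i))" for u v
      by (auto simp: fiber_iff tail_iff dest: lin_Field)
    then show ?thesis by auto
  qed
  have tailI: "(\<lambda>z. c z - c x) ` Field (tail C x) = {0..}"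
    if C: "Linear_order C" "isotone C c" "c ` Field C = K" "K = UNIV \<or> K = {0..}" "x \<in> Field C"
    for C :: "'x rel" and c x and K :: "int set"
  proof
    show "(\<lambda>z. c z - c x) ` Field (tail C x) \<subseteq> {0..}"
      using isotoneD[OF C(2)] unfolding Field_tail[OF C(1)] by auto
    show "{0..} \<subseteq> (\<lambda>z. c z - c x) ` Field (tail C x)"
    proof
      fix i :: int assume i: "i \<in> {0..}"
      show "i \<in> (\<lambda>z. c z - c x) ` Field (tail C x)"
      proof (cases "i = 0")
        case True
        then show ?thesis unfolding Field_tail[OF C(1)] using lin_refl[OF C(1,5)] by auto
      next
        case False
        have "c x \<in> K" using C by auto
        then have "c x + i \<in> K" using C(4) i by auto
        then obtain z where z: "z \<in> Field C" "c z = c x + i" using C(3) by auto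
        then have "(x, z) \<in> C" using isotone_less[OF C(1,2,5), of z] False i by auto
        then show ?thesis unfolding Field_tail[OF C(1)] using z(2) by (intro image_eqI[of _ _ z]) auto
      qed
    qed
  qed
  show ?thesis
    unfolding teq_def
  proof (intro ballI)
    fix x y assume x: "x \<in> Field A" and y: "y \<in> Field B"
    have iso: "isotone (tail A x) (\<lambda>z. d z - d x)" "isotone (tail B y) (\<lambda>z. e z - e y)"
      using LA(2) LB(2) unfolding isotone_def tail_iff by auto
    have dx: "d x \<in> I" "e y \<in> J" using x y LA(3) LB(3) by auto
    show "tail A x \<cong> tail B y"
    proof (rule glue_fibers[OF Linear_order_tail[OF LA(1)] Linear_order_tail[OF LB(1)] iso])
      show "(\<lambda>z. d z - d x) ` Field (tail A x) = (\<lambda>z. e z - e y) ` Field (tail B y)"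
        unfolding tailI[OF LA(1-4) x] tailI[OF LB(1-4) y] ..
      fix i assume "i \<in> (\<lambda>z. d z - d x) ` Field (tail A x)"
      then have i: "0 \<le> i" unfolding tailI[OF LA(1-4) x] by simp
      show "fiber (tail A x) (\<lambda>z. d z - d x) i \<cong> fiber (tail B y) (\<lambda>z. e z - e y) i"
      proof (cases "i = 0")
        case True
        have t: "teq (fiber A d (d x)) M" "teq M N" "teq (fiber B e (e y)) N"
          using A B dx teq_iso[OF MN LA(5)] unfolding layered_def by blast+
        have "teq (fiber A d (d x)) (fiber B e (e y))"
          by (rule teq_trans[OF teq_trans[OF t(1,2) LA(6)] teq_sym[OF t(3)] LB(6)])
        then have "tail (fiber A d (d x)) x \<cong> tail (fiber B e (e y)) y"
          using x y unfolding teq_def Field_fiber[OF LA(1)] Field_fiber[OF LB(1)] by blast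
        then show ?thesis using True by (simp add: tailF[OF LA(1,2) x] tailF[OF LB(1,2) y])
      next
        case False
        have "d x + i \<in> I" "d x + i - 1 \<in> I" "e y + i \<in> J" "e y + i - 1 \<in> J"
          using dx LA(4) LB(4) i False by auto
        then have "fiber A d (d x + i) \<cong> M" "fiber B e (e y + i) \<cong> N"
          using A B unfolding layered_def by blast+
        then have "fiber A d (d x + i) \<cong> M" "N \<cong> fiber B e (e y + i)"
          by (simp_all add: chain_iso_sym)
        then have "fiber A d (d x + i) \<cong> fiber B e (e y + i)" using MN by (meson chain_iso_trans)
        then show ?thesis using False i by (simp add: tailF[OF LA(1,2) x] tailF[OF LB(1,2) y])
      qed
    qed
  qed
qed

lemma layered_uniform: "layered A d I M \<Longrightarrow> uniform A"
  using layered_teq[of A d I M A d I M] unfolding uniform_teq layered_def by simp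

lemma layered_fiber_rank:
  assumes "layered A d I M" "rank_is M a" "i \<in> I" shows "uniform (fiber A d i)" "rank_is (fiber A d i) a"
proof -
  have *: "Linear_order A" "uniform M" "Field M \<noteq> {}" "teq (fiber A d i) M" "i \<in> d ` Field A"
    using assms unfolding layered_def by auto
  then have "Field (fiber A d i) \<noteq> {}" using Field_fiber[OF *(1)] by auto
  then show "uniform (fiber A d i)" "rank_is (fiber A d i) a"
    using uniform_if_teq[OF Linear_order_fiber[OF *(1)] *(4,3)]
      rank_is_teq[OF uniform_Linear[OF *(2)] Linear_order_fiber[OF *(1)] teq_sym[OF *(4)] _ assms(2)] by auto
qed

text \<open>The components of level \<open>\<omega> + n\<close> are the fibers.\<close>

lemma layered_lev_iff:
  assumes A: "layered A d I M" and M: "rank_is M (Inr n)" and x: "x \<in> Field A" and y: "y \<in> Field A"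
  shows "(x, y) \<in> lev (Inr n) A \<longleftrightarrow> d x = d y"
proof -
  have L: "Linear_order A" "isotone A d" "d ` Field A = I" using A unfolding layered_def by auto
  note fib = layered_fiber_rank[OF A M]
  note emb = conv_emb_fiber[OF L(1,2)]
  have less: "(u, v) \<notin> lev (Inr n) A" if uv: "u \<in> Field A" "v \<in> Field A" "d u < d v" for u v
  proof -
    have "d u \<in> I" using uv L(3) by auto
    moreover have "(w, v) \<in> A" if "w \<in> Field (fiber A d (d u))" for w
      using that isotone_less[OF L(1,2) _ uv(2), of w] uv(3) unfolding Field_fiber[OF L(1)] by auto
    moreover have "u \<in> Field (fiber A d (d u))" using uv unfolding Field_fiber[OF L(1)] by auto
    ultimately show ?thesis
      using not_lev_above[OF fib(1) fib(2) emb, of "d u" u v] by simp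
  qed
  show ?thesis
  proof
    assume xy: "(x, y) \<in> lev (Inr n) A"
    then show "d x = d y"
      using less[OF x y] less[OF y x] conveq_sym[OF conveq_lev[OF L(1)] xy] by linarith
  next
    assume xy: "d x = d y"
    have F: "x \<in> Field (fiber A d (d x))" "y \<in> Field (fiber A d (d x))"
      using x y xy unfolding Field_fiber[OF L(1)] by auto
    have "d x \<in> I" using x L(3) by auto
    then have "(x, y) \<in> lev (Inr n) (fiber A d (d x))"
      using fib(2) F unfolding rank_is_def full_def by blast
    then show "(x, y) \<in> lev (Inr n) A" using lev_conv_emb[OF emb F] by simp
  qed
qed

text \<open>The map \<open>d\<close> counts the components of level \<open>\<omega> + n\<close>: from \<open>x\<close> to \<open>y\<close> it grows by one less than the
  number of components that meet the closed interval between them.\<close>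

definition counts :: "'a rel \<Rightarrow> ('a \<Rightarrow> int) \<Rightarrow> nat \<Rightarrow> bool" where
  "counts A d n \<longleftrightarrow> (\<forall>x y. (x, y) \<in> A \<longrightarrow> finite (classes (lev (Inr n) A) (interval A x y)) \<and>
     d y = d x + int (card (classes (lev (Inr n) A) (interval A x y))) - 1)"

lemma layered_counts:
  assumes A: "layered A d I M" and M: "rank_is M (Inr n)" shows "counts A d n"
  unfolding counts_def
proof (intro allI impI)
  fix x y assume xy: "(x, y) \<in> A"
  have L: "Linear_order A" "isotone A d" "d ` Field A = I" "I = UNIV \<or> I = {0..}"
    using A unfolding layered_def by auto
  have F: "x \<in> Field A" "y \<in> Field A" using lin_Field[OF xy] by auto
  let ?J = "interval A x y" and ?E = "lev (Inr n) A"
  have E: "conveq A ?E" by (rule conveq_lev[OF L(1)])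
  have "d ` ?J = {d x..d y}"
  proof
    show "d ` ?J \<subseteq> {d x..d y}" unfolding interval_le[OF L(1) xy] using isotoneD[OF L(2)] by auto
    show "{d x..d y} \<subseteq> d ` ?J"
    proof
      fix i assume i: "i \<in> {d x..d y}"
      consider "i = d x" | "i = d y" | "d x < i" "i < d y" using i by force
      then show "i \<in> d ` ?J"
      proof cases
        case 3
        have "d x \<in> I" using L(3) F by auto
        then have "i \<in> I" using L(4) 3 by auto
        then obtain z where z: "z \<in> Field A" "d z = i" using L(3) by auto
        then show ?thesis
          unfolding interval_le[OF L(1) xy]
          using isotone_less[OF L(1,2) F(1) z(1)] isotone_less[OF L(1,2) z(1) F(2)] 3 by auto
      qed (use interval_ends[OF L(1) F] in auto)
    qed
  qed
  moreover have "bij_betw (\<lambda>i. ?E `` {z. z \<in> ?J \<and> d z = i}) (d ` ?J) (classes ?E ?J)"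
  proof -
    have cl: "?E `` {z. z \<in> ?J \<and> d z = d u} = ?E `` {u}" if u: "u \<in> ?J" for u
    proof
      show "?E `` {u} \<subseteq> ?E `` {z. z \<in> ?J \<and> d z = d u}" using u by blast
      show "?E `` {z. z \<in> ?J \<and> d z = d u} \<subseteq> ?E `` {u}"
      proof
        fix w assume "w \<in> ?E `` {z. z \<in> ?J \<and> d z = d u}"
        then obtain z where z: "z \<in> ?J" "d z = d u" "(z, w) \<in> ?E" by auto
        have "(u, z) \<in> ?E"
          using layered_lev_iff[OF A M, of u z] u z interval_Field[THEN subsetD] by fastforce
        then show "w \<in> ?E `` {u}" using z(3) conveq_trans[OF E] by blast
      qed
    qed
    have cl2: "?E `` {u} = ?E `` {v} \<longleftrightarrow> d u = d v" if "u \<in> ?J" "v \<in> ?J" for u v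
    proof -
      have "u \<in> Field A" "v \<in> Field A" using that interval_Field[THEN subsetD] by fast+
      then show ?thesis using conveq_class_eq[OF E] layered_lev_iff[OF A M] by blast
    qed
    show ?thesis
      unfolding bij_betw_def
    proof
      show "inj_on (\<lambda>i. ?E `` {z. z \<in> ?J \<and> d z = i}) (d ` ?J)"
        by (rule inj_onI) (auto simp: cl cl2)
      show "(\<lambda>i. ?E `` {z. z \<in> ?J \<and> d z = i}) ` d ` ?J = classes ?E ?J"
        unfolding classes_def image_image by (rule image_cong) (simp_all add: cl)
    qed
  qed
  ultimately have b: "bij_betw (\<lambda>i. ?E `` {z. z \<in> ?J \<and> d z = i}) {d x..d y} (classes ?E ?J)" by simp
  have "d x \<le> d y" using isotoneD[OF L(2) xy] .
  then show "finite (classes ?E ?J) \<and> d y = d x + int (card (classes ?E ?J)) - 1"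
    using bij_betw_same_card[OF b] bij_betw_finite[OF b] by simp
qed

lemma layered_rank:
  assumes A: "layered A d I M" and M: "rank_is M (Inr n)" shows "rank_is A (Inr (Suc n))"
proof -
  have L: "Linear_order A" "d ` Field A = I" "I = UNIV \<or> I = {0..}" using A unfolding layered_def by auto
  have "0 \<in> d ` Field A" "1 \<in> d ` Field A" using L by auto
  then obtain x y where xy: "x \<in> Field A" "y \<in> Field A" "d x = 0" "d y = 1" by force
  have "\<not> full A (lev (Inr n) A)"
    using layered_lev_iff[OF A M xy(1,2)] xy unfolding full_def by auto
  moreover have "(u, v) \<in> lev (Inr (Suc n)) A" if uv: "u \<in> Field A" "v \<in> Field A" for u v
  proof -
    have "finite (classes (lev (Inr n) A) (interval A u v))"
      using layered_counts[OF A M] lin_total[OF L(1) uv] unfolding counts_def by (metis interval_sym)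
    then show ?thesis unfolding lev_Inr_Suc condense_iff[OF L(1) conveq_lev[OF L(1)]] using uv by blast
  qed
  ultimately show ?thesis unfolding rank_is_Suc[OF L(1)] full_def using xy by blast
qed

lemma counts_isotone: "Linear_order A \<Longrightarrow> counts A d n \<Longrightarrow> isotone A d"
  unfolding isotone_def
proof (intro allI impI)
  fix x y assume *: "Linear_order A" "counts A d n" "(x, y) \<in> A"
  have "x \<in> interval A x y" using interval_ends[of A x y] * lin_Field[OF *(3)] by blast
  then have "classes (lev (Inr n) A) (interval A x y) \<noteq> {}" unfolding classes_def by blast
  then have "card (classes (lev (Inr n) A) (interval A x y)) \<noteq> 0"
    using * card_0_eq unfolding counts_def by metis
  then show "d x \<le> d y" using * unfolding counts_def by fastforce
qed

text \<open>An isomorphism of tails respects the counting of components, hence matches the components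
  above the least element, and the remaining parts of the component of that element.\<close>

lemma counts_tail_iso:
  assumes LA: "Linear_order A" and LB: "Linear_order B" and A: "counts A d n" and B: "counts B e n"
    and x: "x \<in> Field A" and y: "y \<in> Field B" and iso: "tail A x \<cong> tail B y"
  shows "j \<ge> 1 \<Longrightarrow> fiber A d (d x + j) \<cong> fiber B e (e y + j)"
    and "tail (fiber A d (d x)) x \<cong> tail (fiber B e (e y)) y"
proof -
  obtain g where g: "conv_emb g (tail A x) B" "g ` {z. (x, z) \<in> A} = {z. (y, z) \<in> B}" "g x = y"
    using tail_isoE[OF LA LB iso x y] by blast
  have iA: "isotone A d" and iB: "isotone B e" using counts_isotone LA LB A B by blast+
  note LT = Linear_order_tail[OF LA, of x]
  have giff: "(u, v) \<in> A \<longleftrightarrow> (g u, g v) \<in> B" if "(x, u) \<in> A" "(x, v) \<in> A" for u v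
    using g(1) that unfolding conv_emb_def by (auto simp: Field_tail[OF LA] tail_iff)
  have cnt: "e (g z) - e y = d z - d x" if z: "(x, z) \<in> A" for z
  proof -
    have yz: "(y, g z) \<in> B" using g(2) z by auto
    have F: "x \<in> Field (tail A x)" "z \<in> Field (tail A x)"
      unfolding Field_tail[OF LA] using lin_refl[OF LA x] z by auto
    have card: "card (classes (lev (Inr n) (tail A x)) (interval (tail A x) x z)) =
      card (classes (lev (Inr n) C) (interval C (f x) (f z)))" if f: "conv_emb f (tail A x) C"
      for f :: "'a \<Rightarrow> 'c" and C
    proof -
      have "Linear_order C" "f ` Field (tail A x) \<subseteq> Field C" using f unfolding conv_emb_def by auto
      then show ?thesis
        unfolding conv_emb_interval[OF f F]
        using pulls_back_card_classes[OF conveq_lev[OF LT] conveq_lev _ pulls_back_lev[OF f] interval_Field]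
        by blast
    qed
    have "card (classes (lev (Inr n) A) (interval A x z)) =
        card (classes (lev (Inr n) B) (interval B (g x) (g z)))"
      using card[OF conv_emb_tail[OF LA]] card[OF g(1)] by simp
    then show ?thesis using A B z yz g(3) unfolding counts_def by auto
  qed
  have cut: "Restr A {z. (x, z) \<in> A \<and> d z = d x + j} \<cong> Restr B {z. (y, z) \<in> B \<and> e z = e y + j}" for j
  proof (rule chain_isoI[of _ _ g])
    show "Linear_order (Restr A {z. (x, z) \<in> A \<and> d z = d x + j})"
      "Linear_order (Restr B {z. (y, z) \<in> B \<and> e z = e y + j})"
      using LA LB Linear_order_Restr' by blast+
    have F: "Field (Restr A {z. (x, z) \<in> A \<and> d z = d x + j}) = {z. (x, z) \<in> A \<and> d z = d x + j}"
      "Field (Restr B {z. (y, z) \<in> B \<and> e z = e y + j}) = {z. (y, z) \<in> B \<and> e z = e y + j}"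
      unfolding Field_Restr_lin[OF LA] Field_Restr_lin[OF LB] by (auto dest: lin_Field)
    show "g ` Field (Restr A {z. (x, z) \<in> A \<and> d z = d x + j}) =
        Field (Restr B {z. (y, z) \<in> B \<and> e z = e y + j})"
      unfolding F
    proof
      show "g ` {z. (x, z) \<in> A \<and> d z = d x + j} \<subseteq> {z. (y, z) \<in> B \<and> e z = e y + j}"
        using g(2) cnt by force
      show "{z. (y, z) \<in> B \<and> e z = e y + j} \<subseteq> g ` {z. (x, z) \<in> A \<and> d z = d x + j}"
      proof
        fix w assume w: "w \<in> {z. (y, z) \<in> B \<and> e z = e y + j}"
        then obtain z where z: "(x, z) \<in> A" "w = g z" using g(2) by blast
        then show "w \<in> g ` {z. (x, z) \<in> A \<and> d z = d x + j}" using cnt[OF z(1)] w by auto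
      qed
    qed
    fix u v assume "u \<in> Field (Restr A {z. (x, z) \<in> A \<and> d z = d x + j})"
      "v \<in> Field (Restr A {z. (x, z) \<in> A \<and> d z = d x + j})"
    then have uv: "(x, u) \<in> A" "d u = d x + j" "(x, v) \<in> A" "d v = d x + j" unfolding F by auto
    then have "(y, g u) \<in> B" "(y, g v) \<in> B" using g(2) by auto
    then show "(u, v) \<in> Restr A {z. (x, z) \<in> A \<and> d z = d x + j} \<longleftrightarrow>
        (g u, g v) \<in> Restr B {z. (y, z) \<in> B \<and> e z = e y + j}"
      using giff[OF uv(1,3)] cnt[OF uv(1)] cnt[OF uv(3)] uv by auto
  qed
  have above: "Restr C {z. (u, z) \<in> C \<and> c z = c u + j} = fiber C c (c u + j)"
    if C: "Linear_order C" "isotone C c" "u \<in> Field C" and j: "j \<ge> 1" for C :: "'x rel" and c u j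
  proof -
    have "(u, z) \<in> C" if "z \<in> Field C" "c z = c u + j" for z
      using isotone_less[OF C that(1)] that(2) j by simp
    then have "(v, w) \<in> Restr C {z. (u, z) \<in> C \<and> c z = c u + j} \<longleftrightarrow> (v, w) \<in> fiber C c (c u + j)" for v w
      unfolding fiber_iff by (auto dest: lin_Field)
    then show ?thesis by auto
  qed
  show "fiber A d (d x + j) \<cong> fiber B e (e y + j)" if j: "j \<ge> 1"
    using cut[of j] above[OF LA iA x j] above[OF LB iB y j] by simp
  have "Restr C {z. (u, z) \<in> C \<and> c z = c u + 0} = tail (fiber C c (c u)) u" for C :: "'x rel" and c :: "'x \<Rightarrow> int" and u
    unfolding tail_def above_def fiber_def by auto
  then show "tail (fiber A d (d x)) x \<cong> tail (fiber B e (e y)) y" using cut[of 0] by metis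
qed

text \<open>The tails of a layered chain determine the repeated component.\<close>

lemma layered_unique:
  assumes A: "layered A d I M" "rank_is M (Inr n)" and B: "layered B e J N" "rank_is N (Inr n)"
    and t: "teq A B"
  shows "M \<cong> N"
proof -
  have LA: "Linear_order A" "d ` Field A = I" "I = UNIV \<or> I = {0..}" using A unfolding layered_def by auto
  have LB: "Linear_order B" "e ` Field B = J" "J = UNIV \<or> J = {0..}" using B unfolding layered_def by auto
  have "0 \<in> d ` Field A" "0 \<in> e ` Field B" using LA LB by auto
  then obtain x y where xy: "x \<in> Field A" "d x = 0" "y \<in> Field B" "e y = 0" by force
  then have "tail A x \<cong> tail B y" using t unfolding teq_def by blast
  then have "fiber A d 1 \<cong> fiber B e 1"
    using counts_tail_iso(1)[OF LA(1) LB(1) layered_counts[OF A] layered_counts[OF B] xy(1,3), of 1] xy by simp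
  moreover have "fiber A d 1 \<cong> M" "fiber B e 1 \<cong> N"
    using A(1) B(1) LA(3) LB(3) unfolding layered_def by auto
  ultimately show ?thesis by (meson chain_iso_sym chain_iso_trans)
qed

text \<open>If \<open>\<rho>\<close> relates all elements at level \<open>\<omega> + n + 1\<close>, there are only finitely many components of
  level \<open>\<omega> + n\<close> between any two elements, so these can be counted from a base point.\<close>

lemma counts_exist:
  assumes L: "Linear_order A" and fullA: "full A (lev (Inr (Suc n)) A)"
  shows "\<exists>d. counts A d n"
proof (cases "Field A = {}")
  case True
  then have "(x, y) \<notin> A" for x y using lin_Field[of x y A] by blast
  then show ?thesis unfolding counts_def by simp
next
  case False
  then obtain e where e: "e \<in> Field A" by blast
  define E where "E = lev (Inr n) A"
  have E: "conveq A E" unfolding E_def by (rule conveq_lev[OF L])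
  define c where "c x y = int (card (classes E (interval A x y))) - 1" for x y
  have fin: "finite (classes E (interval A x y))" if "x \<in> Field A" "y \<in> Field A" for x y
    using fullA that condense_iff[OF L E] unfolding full_def lev_Inr_Suc E_def by blast
  \<comment> \<open>Consecutive intervals share exactly the class of their common end point.\<close>
  have add: "c x z = c x y + c y z" if xy: "(x, y) \<in> A" and yz: "(y, z) \<in> A" for x y z
  proof -
    have F: "x \<in> Field A" "y \<in> Field A" "z \<in> Field A" using lin_Field[OF xy] lin_Field[OF yz] by auto
    have xz: "(x, z) \<in> A" by (rule lin_trans[OF L xy yz])
    have "interval A x z = interval A x y \<union> interval A y z"
      using interval_tri[OF L F] lin_trans[OF L] xy yz
      unfolding interval_le[OF L xy] interval_le[OF L yz] interval_le[OF L xz] by blast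
    then have U: "classes E (interval A x z) = classes E (interval A x y) \<union> classes E (interval A y z)"
      by (simp add: classes_Un)
    have "classes E (interval A x y) \<inter> classes E (interval A y z) = {E `` {y}}"
    proof
      show "{E `` {y}} \<subseteq> classes E (interval A x y) \<inter> classes E (interval A y z)"
        using interval_ends[OF L] F unfolding classes_def by blast
      show "classes E (interval A x y) \<inter> classes E (interval A y z) \<subseteq> {E `` {y}}"
      proof
        fix C assume "C \<in> classes E (interval A x y) \<inter> classes E (interval A y z)"
        then obtain u v where uv: "u \<in> interval A x y" "v \<in> interval A y z" "C = E `` {u}" "C = E `` {v}"
          unfolding classes_def by auto
        then have le: "(u, y) \<in> A" "(y, v) \<in> A" unfolding interval_le[OF L xy] interval_le[OF L yz] by auto
        then have F': "u \<in> Field A" "v \<in> Field A" using lin_Field by metis+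
        then have "(u, v) \<in> E" using conveq_class_eq[OF E] uv by blast
        then have "(u, y) \<in> E" using conveq_convex[OF E le] by blast
        then show "C \<in> {E `` {y}}" using conveq_class_eq[OF E F'(1) F(2)] uv by blast
      qed
    qed
    then have "card (classes E (interval A x z)) + 1 =
        card (classes E (interval A x y)) + card (classes E (interval A y z))"
      unfolding U using card_Un_Int[OF fin[OF F(1,2)] fin[OF F(2,3)]] by simp
    then show ?thesis unfolding c_def by linarith
  qed
  have self: "c x x = 0" if "x \<in> Field A" for x
    using add[OF lin_refl[OF L that] lin_refl[OF L that]] by simp
  define d where "d y = (if (e, y) \<in> A then c e y else - c y e)" for y
  have neg: "d y = - c y e" if "(y, e) \<in> A" for y
    using that self[OF e] lin_antisym[OF L, of e y] unfolding d_def by auto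
  have "d y = d x + c x y" if xy: "(x, y) \<in> A" for x y
  proof -
    have F: "x \<in> Field A" "y \<in> Field A" using lin_Field[OF xy] by auto
    consider "(e, x) \<in> A" | "(x, e) \<in> A" "(e, y) \<in> A" | "(y, e) \<in> A"
      using lin_total[OF L e] F by blast
    then show ?thesis
    proof cases
      case 1
      then show ?thesis using add[OF 1 xy] lin_trans[OF L 1 xy] unfolding d_def by simp
    next
      case 2
      then show ?thesis using add[OF 2] neg[OF 2(1)] unfolding d_def[of y] by simp
    next
      case 3
      then show ?thesis using add[OF xy 3] neg[OF 3] neg[OF lin_trans[OF L xy 3]] by simp
    qed
  qed
  then have "counts A d n"
    unfolding counts_def using fin lin_Field unfolding c_def E_def by (metis add_diff_eq)
  then show ?thesis by blast
qed

lemma counts_eq_iff: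
  assumes L: "Linear_order A" and d: "counts A d n" and xy: "(x, y) \<in> A"
  shows "d x = d y \<longleftrightarrow> (x, y) \<in> lev (Inr n) A"
proof -
  let ?E = "lev (Inr n) A" and ?J = "interval A x y"
  have E: "conveq A ?E" by (rule conveq_lev[OF L])
  have F: "x \<in> Field A" "y \<in> Field A" using lin_Field[OF xy] by auto
  have c: "finite (classes ?E ?J)" "d y = d x + int (card (classes ?E ?J)) - 1"
    using d xy unfolding counts_def by auto
  have in_cl: "?E `` {x} \<in> classes ?E ?J" "?E `` {y} \<in> classes ?E ?J"
    using interval_ends[OF L F] unfolding classes_def by auto
  show ?thesis
  proof
    assume "d x = d y"
    then have "card (classes ?E ?J) = 1" using c by linarith
    then have "?E `` {x} = ?E `` {y}" using in_cl by (auto simp: card_1_singleton_iff)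
    then show "(x, y) \<in> ?E" using conveq_class_eq[OF E F] by simp
  next
    assume xyE: "(x, y) \<in> ?E"
    have "classes ?E ?J \<subseteq> {?E `` {x}}"
    proof (rule classes_single[OF E])
      fix z assume "z \<in> ?J"
      then show "(x, z) \<in> ?E" using conveq_convex[OF E _ _ xyE] unfolding interval_le[OF L xy] by blast
    qed
    then have "classes ?E ?J = {?E `` {x}}" using in_cl by blast
    then show "d x = d y" using c by simp
  qed
qed

lemma counts_onto:
  assumes L: "Linear_order A" and d: "counts A d n" and xy: "(x, y) \<in> A" and i: "d x \<le> i" "i \<le> d y"
  shows "i \<in> d ` Field A"
  using xy i
proof (induction "nat (d y - d x)" arbitrary: x y rule: less_induct)
  case less
  let ?E = "lev (Inr n) A" and ?J = "interval A x y"
  have F: "x \<in> Field A" "y \<in> Field A" using lin_Field[OF less.prems(1)] by auto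
  note iso = isotoneD[OF counts_isotone[OF L d]]
  show ?case
  proof (cases "i = d x \<or> i = d y")
    case False
    then have "d y - d x \<ge> 2" using less.prems by linarith
    then have "card (classes ?E ?J) \<ge> 3" "finite (classes ?E ?J)"
      using d less.prems(1) unfolding counts_def by fastforce+
    then have "\<not> classes ?E ?J \<subseteq> {?E `` {x}, ?E `` {y}}"
      using card_mono[of "{?E `` {x}, ?E `` {y}}" "classes ?E ?J"] card_insert_le_m1[of 2 "{?E `` {y}}" "?E `` {x}"]
      by fastforce
    then obtain z where z: "z \<in> ?J" "?E `` {z} \<noteq> ?E `` {x}" "?E `` {z} \<noteq> ?E `` {y}"
      unfolding classes_def by auto
    have le: "(x, z) \<in> A" "(z, y) \<in> A" using z(1) unfolding interval_le[OF L less.prems(1)] by auto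
    have "z \<in> Field A" using lin_Field[OF le(1)] by blast
    then have "d x \<noteq> d z" "d z \<noteq> d y"
      using counts_eq_iff[OF L d le(1)] counts_eq_iff[OF L d le(2)] z(2,3)
        conveq_class_eq[OF conveq_lev[OF L]] F by metis+
    then have lt: "d x < d z" "d z < d y" using iso[OF le(1)] iso[OF le(2)] by auto
    show ?thesis
    proof (cases "i \<le> d z")
      case True
      then show ?thesis using less.hyps[of z x] le(1) lt less.prems by simp
    next
      case False
      then show ?thesis using less.hyps[of y z] le(2) lt less.prems by simp
    qed
  qed (use F in auto)
qed

lemma counts_shift: "counts A d n \<Longrightarrow> counts A (\<lambda>x. d x - m) n"
  unfolding counts_def by auto

lemma int_bounded_below_min:
  fixes S :: "int set"
  assumes "S \<noteq> {}" "\<And>x. x \<in> S \<Longrightarrow> l \<le> x" shows "\<exists>m\<in>S. \<forall>x\<in>S. m \<le> x"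
proof -
  obtain a where "a \<in> S" using assms(1) by blast
  then obtain m where "m \<in> S" "\<forall>x. x \<in> S \<longrightarrow> nat (m - l) \<le> nat (x - l)"
    using ex_has_least_nat[of "\<lambda>x. x \<in> S" a "\<lambda>x. nat (x - l)"] by blast
  then show ?thesis using assms(2) by (intro bexI[of _ m]) (force simp: nat_le_eq_zle)+
qed

text \<open>Every uniform chain of rank \<open>\<omega> + n + 1\<close> is layered over a chain of rank \<open>\<omega> + n\<close>. Uniformity
  excludes a last component, so that the components are indexed by \<open>\<int>\<close> or \<open>\<nat>\<close>.\<close>

lemma uniform_layered:
  assumes U: "uniform A" and r: "rank_is A (Inr (Suc n))"
  shows "\<exists>d I. layered A d I (fiber A d 1) \<and> rank_is (fiber A d 1) (Inr n)"
proof -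
  have L: "Linear_order A" and t: "teq A A" using U unfolding uniform_teq by auto
  have ne: "Field A \<noteq> {}" and fA: "full A (lev (Inr (Suc n)) A)" and nf: "\<not> full A (lev (Inr n) A)"
    using r unfolding rank_is_Suc[OF L] by auto
  have up: "\<exists>y. (x, y) \<in> A \<and> d x < d y" if x: "x \<in> Field A" and d: "counts A d n" for d x
  proof -
    obtain y where y: "(x, y) \<in> A" "(x, y) \<notin> lev (Inr n) A" using tail_full[OF L L t x] nf by blast
    then show ?thesis using counts_eq_iff[OF L d y(1)] isotoneD[OF counts_isotone[OF L d] y(1)] by force
  qed
  have up_any: "i \<in> d ` Field A" if x: "x \<in> Field A" and d: "counts A d n" and i: "d x \<le> i" for d i x
  proof -
    have "\<exists>y. (x, y) \<in> A \<and> d x + int k \<le> d y" for k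
    proof (induction k)
      case 0
      then show ?case using lin_refl[OF L x] by auto
    next
      case (Suc k)
      then obtain y where y: "(x, y) \<in> A" "d x + int k \<le> d y" by blast
      then obtain z where "(y, z) \<in> A" "d y < d z" using up[OF _ d, of y] lin_Field[OF y(1)] by blast
      then show ?case using lin_trans[OF L y(1)] y(2) by (intro exI[of _ z]) auto
    qed
    from this[of "nat (i - d x)"] obtain y where "(x, y) \<in> A" "i \<le> d y" using i by auto
    then show ?thesis using counts_onto[OF L d _ i] by blast
  qed
  obtain d0 where d0: "counts A d0 n" using counts_exist[OF L fA] by blast
  have "\<exists>d. counts A d n \<and> (d ` Field A = UNIV \<or> d ` Field A = {0..})"
  proof (cases "\<exists>l. \<forall>x\<in>Field A. l \<le> d0 x")
    case True
    then obtain l where "\<And>i. i \<in> d0 ` Field A \<Longrightarrow> l \<le> i" by auto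
    then obtain m where m: "m \<in> Field A" "\<forall>x\<in>Field A. d0 m \<le> d0 x"
      using int_bounded_below_min[of "d0 ` Field A" l] ne by auto
    define d where "d x = d0 x - d0 m" for x
    have "counts A d n" unfolding d_def by (rule counts_shift[OF d0])
    moreover have "d ` Field A = {0..}"
    proof
      show "d ` Field A \<subseteq> {0..}" unfolding d_def using m by auto
      show "{0..} \<subseteq> d ` Field A" using up_any[OF m(1) \<open>counts A d n\<close>] unfolding d_def by auto
    qed
    ultimately show ?thesis by blast
  next
    case False
    have "i \<in> d0 ` Field A" for i
    proof -
      obtain x where "x \<in> Field A" "d0 x < i" using False by (meson linorder_not_le)
      then show ?thesis using up_any[OF _ d0, of x i] by simp
    qed
    then show ?thesis using d0 by blast
  qed
  then obtain d where d: "counts A d n" and I: "d ` Field A = UNIV \<or> d ` Field A = {0..}" by blast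
  define I where "I = d ` Field A"
  define M where "M = fiber A d 1"
  have iso: "isotone A d" by (rule counts_isotone[OF L d])
  have LM: "Linear_order M" unfolding M_def by (rule Linear_order_fiber[OF L])
  have fib_teq: "teq (fiber A d i) (fiber A d j)" for i j
    unfolding teq_def Field_fiber[OF L]
    using counts_tail_iso(2)[OF L L d d] U unfolding uniform_def by blast
  have "1 \<in> d ` Field A" using I by auto
  then have neM: "Field M \<noteq> {}" unfolding M_def Field_fiber[OF L] by auto
  have uM: "uniform M" unfolding uniform_teq using LM fib_teq M_def by simp
  have fib_iso: "fiber A d i \<cong> M" if i: "i - 1 \<in> I" for i
  proof -
    have "0 \<in> d ` Field A" using I by auto
    then obtain x y where xy: "x \<in> Field A" "d x = i - 1" "y \<in> Field A" "d y = 0"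
      using i unfolding I_def by force
    then have "tail A x \<cong> tail A y" using U unfolding uniform_def by blast
    then show ?thesis
      using counts_tail_iso(1)[OF L L d d xy(1,3), of 1] xy unfolding M_def by simp
  qed
  have lay: "layered A d I M"
    unfolding layered_def using L iso I uM neM fib_teq fib_iso unfolding M_def I_def by blast
  have sameE: "(x, y) \<in> lev (Inr n) A \<longleftrightarrow> d x = d y" if "x \<in> Field A" "y \<in> Field A" for x y
    using lin_total[OF L that] counts_eq_iff[OF L d] conveq_sym[OF conveq_lev[OF L]] by metis
  have emb: "conv_emb id (fiber A d i) A" for i by (rule conv_emb_fiber[OF L iso])
  have "rank_is M (Inr n)"
    unfolding rank_is_def
  proof (intro conjI allI impI)
    show "Field M \<noteq> {}" by (rule neM)
    show "full M (lev (Inr n) M)"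
      using sameE lev_conv_emb[OF emb, of _ 1 _ "Inr n"]
      unfolding full_def M_def by (simp add: Field_fiber[OF L])
    fix b assume b: "before b (Inr n)"
    show "\<not> full M (lev b M)"
    proof
      assume "full M (lev b M)"
      then have fib_full: "full (fiber A d i) (lev b (fiber A d i))" for i
        using full_teq[OF LM Linear_order_fiber[OF L] _ neM] fib_teq unfolding M_def by blast
      have "lev (Inr n) A \<subseteq> lev b A"
      proof (rule subrelI)
        fix x y assume xy: "(x, y) \<in> lev (Inr n) A"
        then have F: "x \<in> Field A" "y \<in> Field A" using conveq_Field[OF conveq_lev[OF L]] by blast+
        then have "x \<in> Field (fiber A d (d x))" "y \<in> Field (fiber A d (d x))"
          using sameE[OF F] xy unfolding Field_fiber[OF L] by auto
        then show "(x, y) \<in> lev b A"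
          using fib_full[of "d x"] lev_conv_emb[OF emb] unfolding full_def by (metis id_apply)
      qed
      then have "condense A (lev (Inr n) A) \<subseteq> condense A (lev b A)"
        by (rule condense_mono[OF L conveq_lev[OF L] conveq_lev[OF L]])
      \<comment> \<open>The sequence of the relations would become stationary before all elements are related.\<close>
      then have "lev (Inr (Suc n)) A \<subseteq> lev (Inr n) A"
        using condense_lev_before[OF L b] unfolding lev_Inr_Suc by blast
      then show False using fA nf full_mono by blast
    qed
  qed
  then show ?thesis using lay unfolding M_def by blast
qed

section \<open>Ordinals below \<open>\<omega> + \<omega>\<close> and rank\<close>


lemma chain_sum_iff [simp]:
  "(Inl a, Inl a') \<in> A \<oplus> B \<longleftrightarrow> (a, a') \<in> A"
  "(Inr b, Inr b') \<in> A \<oplus> B \<longleftrightarrow> (b, b') \<in> B"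
  "(Inl a, Inr b) \<in> A \<oplus> B \<longleftrightarrow> a \<in> Field A \<and> b \<in> Field B"
  "(Inr b, Inl a) \<notin> A \<oplus> B"
  unfolding chain_sum_def by auto

lemma Field_iff: "x \<in> Field r \<longleftrightarrow> (\<exists>y. (x, y) \<in> r \<or> (y, x) \<in> r)"
  unfolding Field_def by blast

lemma Field_chain_sum: "Field (A \<oplus> B) = Inl ` Field A \<union> Inr ` Field B"
proof -
  have "x \<in> Field (A \<oplus> B) \<longleftrightarrow> x \<in> Inl ` Field A \<union> Inr ` Field B" for x
  proof (cases x)
    case (Inl a)
    have "Inl a \<in> Field (A \<oplus> B) \<longleftrightarrow> a \<in> Field A"
      unfolding Field_iff[of "Inl a"] split_sum_ex by (auto simp: Field_iff[of a])
    then show ?thesis unfolding Inl by auto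
  next
    case (Inr b)
    have "Inr b \<in> Field (A \<oplus> B) \<longleftrightarrow> b \<in> Field B"
      unfolding Field_iff[of "Inr b"] split_sum_ex by (auto simp: Field_iff[of b])
    then show ?thesis unfolding Inr by auto
  qed
  then show ?thesis by blast
qed

lemma Linear_order_chain_sum:
  assumes A: "Linear_order A" and B: "Linear_order B" shows "Linear_order (A \<oplus> B)"
proof (rule lin_orderI)
  fix x assume "x \<in> Field (A \<oplus> B)"
  then show "(x, x) \<in> A \<oplus> B" unfolding Field_chain_sum using lin_refl[OF A] lin_refl[OF B] by auto
next
  fix x y z assume "(x, y) \<in> A \<oplus> B" "(y, z) \<in> A \<oplus> B"
  then show "(x, z) \<in> A \<oplus> B"
    by (cases x; cases y; cases z) (auto intro: lin_trans[OF A] lin_trans[OF B] dest: lin_Field)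
next
  fix x y assume "(x, y) \<in> A \<oplus> B" "(y, x) \<in> A \<oplus> B"
  then show "x = y" by (cases x; cases y) (auto dest: lin_antisym[OF A] lin_antisym[OF B])
next
  fix x y assume "x \<in> Field (A \<oplus> B)" "y \<in> Field (A \<oplus> B)"
  then show "(x, y) \<in> A \<oplus> B \<or> (y, x) \<in> A \<oplus> B"
    unfolding Field_chain_sum using lin_total[OF A] lin_total[OF B] by (cases x; cases y) auto
qed

text \<open>The ordinal with index \<open>a\<close>, as an initial segment of \<open>\<omega> + \<omega>\<close>.\<close>

definition seg :: "nat + nat \<Rightarrow> (nat + nat) rel" where
  "seg a = initial (natLeq \<oplus> natLeq) a"

lemma Well_order_omega2: "Well_order (natLeq \<oplus> natLeq)"
proof -
  have "(natLeq \<oplus> natLeq) - Id \<subseteq> inv_image (less_than <*lex*> less_than) (case_sum (\<lambda>k. (0, k)) (\<lambda>n. (Suc 0, n)))"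
    unfolding chain_sum_def natLeq_def by auto
  then have "wf ((natLeq \<oplus> natLeq) - Id)"
    using wf_subset wf_inv_image wf_lex_prod wf_less_than by metis
  then show ?thesis
    unfolding well_order_on_def using Linear_order_chain_sum[OF natLeq_Linear_order natLeq_Linear_order] by blast
qed

lemma Field_omega2: "Field (natLeq \<oplus> natLeq) = UNIV"
  unfolding Field_chain_sum Field_natLeq by (metis UNIV_sum)

lemma before_iff: "before a b \<longleftrightarrow> (a, b) \<in> natLeq \<oplus> natLeq \<and> a \<noteq> b"
  by (cases a; cases b) (auto simp: natLeq_def Field_def)

lemma underS_omega2: "underS (natLeq \<oplus> natLeq) a = {b. before b a}"
  unfolding underS_def before_iff by auto

lemma seg_iff: "(b, c) \<in> seg a \<longleftrightarrow> before b a \<and> before c a \<and> (b, c) \<in> natLeq \<oplus> natLeq"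
  unfolding seg_def initial_def underS_omega2 by auto

lemma Field_seg: "Field (seg a) = {b. before b a}"
proof -
  have "Linear_order (natLeq \<oplus> natLeq)" using Well_order_omega2 unfolding well_order_on_def by blast
  then show ?thesis
    unfolding seg_def initial_def underS_omega2 by (simp add: Field_Restr_lin Field_omega2)
qed

lemma Well_order_seg: "Well_order (seg a)"
  unfolding seg_def initial_def by (rule Well_order_Restr[OF Well_order_omega2])

lemma before_trans: "before a b \<Longrightarrow> before b c \<Longrightarrow> before a c"
  by (cases a; cases b; cases c) auto

lemma initial_seg: assumes "before b a" shows "initial (seg a) b = seg b"
proof -
  have "underS (seg a) b = {c. before c b}"
    unfolding underS_def using assms by (auto simp: seg_iff before_iff[of _ b] intro: before_trans)
      (metis before_iff before_trans)
  moreover have "(x, y) \<in> Restr (seg a) {c. before c b} \<longleftrightarrow> (x, y) \<in> seg b" for x y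
    using before_trans[OF _ assms] by (auto simp: seg_iff)
  ultimately show ?thesis unfolding initial_def[of "seg a"] by auto
qed

lemma seg_Inr: "seg (Inr n) = natLeq \<oplus> natLeq_on n"
proof -
  have "(x, y) \<in> seg (Inr n) \<longleftrightarrow> (x, y) \<in> natLeq \<oplus> natLeq_on n" for x y
    by (cases x; cases y) (auto simp: seg_iff Field_natLeq Field_natLeq_on, auto simp: natLeq_def)
  then show ?thesis by auto
qed

lemma natLeq_seg: "natLeq =o seg (Inr 0)"
proof -
  have F: "Field (seg (Inr 0)) = range Inl"
  proof -
    have "before b (Inr 0) \<longleftrightarrow> b \<in> range Inl" for b by (cases b) auto
    then show ?thesis unfolding Field_seg by auto
  qed
  have "Linear_order (seg (Inr 0))" using Well_order_seg unfolding well_order_on_def by blast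
  moreover have "(Inl x, Inl y) \<in> seg (Inr 0) \<longleftrightarrow> (x, y) \<in> natLeq" for x y
    unfolding seg_iff by simp
  ultimately have "natLeq \<cong> seg (Inr 0)"
    by (intro chain_isoI[OF natLeq_Linear_order, of _ Inl]) (auto simp: F Field_natLeq)
  then show ?thesis
    unfolding chain_iso_def ordIso_def using natLeq_Well_order Well_order_seg by blast
qed

lemma greatest_unique: "Well_order \<alpha> \<Longrightarrow> greatest \<alpha> m \<Longrightarrow> (THE m. greatest \<alpha> m) = m"
  unfolding greatest_def well_order_on_def
  by (rule the_equality) (auto intro: lin_antisym[of \<alpha>])

lemma rho_greatest:
  assumes "Well_order \<alpha>" "greatest \<alpha> m" shows "rho A \<alpha> = condense A (rho A (initial \<alpha> m))"
proof -
  have "Field \<alpha> \<noteq> {}" "\<exists>m. greatest \<alpha> m" using assms(2) unfolding greatest_def by auto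
  then show ?thesis using assms by (subst rho.simps) (simp add: greatest_unique[OF assms])
qed

lemma rho_limit:
  assumes "Well_order \<alpha>" "Field \<alpha> \<noteq> {}" "\<nexists>m. greatest \<alpha> m"
  shows "rho A \<alpha> = (\<Union>b\<in>Field \<alpha>. rho A (initial \<alpha> b))"
proof -
  show ?thesis using assms by (subst rho.simps) auto
qed

lemma rho_zero: "Well_order \<alpha> \<Longrightarrow> Field \<alpha> = {} \<Longrightarrow> rho A \<alpha> = Id_on (Field A)"
  by (subst rho.simps) simp

lemma rho_seg: "rho A (seg a) = lev a A"
proof -
  have succ: "rho A (seg a) = condense A (rho A (seg b))"
    if "before b a" "\<And>c. before c a \<Longrightarrow> before c b \<or> c = b" for a b
  proof -
    have "(c, b) \<in> seg a" if "before c a" for c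
      using \<open>before b a\<close> that(1) \<open>\<And>c. before c a \<Longrightarrow> before c b \<or> c = b\<close>[OF that(1)]
        lin_refl[of "natLeq \<oplus> natLeq" b] Well_order_omega2 Field_omega2
      unfolding seg_iff well_order_on_def by (auto simp: before_iff)
    then have "greatest (seg a) b" unfolding greatest_def Field_seg using that(1) by blast
    then show ?thesis using rho_greatest[OF Well_order_seg] initial_seg[OF that(1)] by metis
  qed
  have fin: "rho A (seg (Inl k)) = lev (Inl k) A" for k
  proof (induction k)
    case 0
    have "Field (seg (Inl 0)) = {}"
    proof -
      have "\<not> before b (Inl 0)" for b by (cases b) auto
      then show ?thesis unfolding Field_seg by auto
    qed
    then show ?case using rho_zero[OF Well_order_seg] by (simp add: lev.simps)
  next
    case (Suc k)
    have "rho A (seg (Inl (Suc k))) = condense A (rho A (seg (Inl k)))"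
    proof (rule succ)
      show "before c (Inl k) \<or> c = Inl k" if "before c (Inl (Suc k))" for c
        using that by (cases c) auto
    qed simp
    then show ?case unfolding Suc lev_Inl_Suc .
  qed
  have lim: "rho A (seg (Inr 0)) = lev (Inr 0) A"
  proof -
    have iff: "before b (Inr 0) \<longleftrightarrow> (\<exists>k. b = Inl k)" for b by (cases b) auto
    have "\<not> greatest (seg (Inr 0)) m" for m
    proof
      assume g: "greatest (seg (Inr 0)) m"
      then obtain k where k: "m = Inl k" unfolding greatest_def Field_seg iff by auto
      have "(Inl (Suc k), m) \<in> seg (Inr 0)" using g unfolding greatest_def Field_seg iff by blast
      then show False unfolding k seg_iff by (simp add: natLeq_def)
    qed
    moreover have "Field (seg (Inr 0)) \<noteq> {}" unfolding Field_seg iff by blast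
    ultimately have "rho A (seg (Inr 0)) = (\<Union>b\<in>Field (seg (Inr 0)). rho A (initial (seg (Inr 0)) b))"
      by (intro rho_limit[OF Well_order_seg]) auto
    also have "\<dots> = (\<Union>k. lev (Inl k) A)"
    proof -
      have "rho A (initial (seg (Inr 0)) (Inl k)) = lev (Inl k) A" for k
        using initial_seg[of "Inl k" "Inr 0"] fin by simp
      moreover have "Field (seg (Inr 0)) = range Inl" unfolding Field_seg iff by auto
      ultimately show ?thesis by simp
    qed
    finally show ?thesis unfolding lev_Inr_0 .
  qed
  have inf: "rho A (seg (Inr n)) = lev (Inr n) A" for n
  proof (induction n)
    case 0
    then show ?case by (rule lim)
  next
    case (Suc n)
    have "rho A (seg (Inr (Suc n))) = condense A (rho A (seg (Inr n)))"
    proof (rule succ)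
      show "before c (Inr n) \<or> c = Inr n" if "before c (Inr (Suc n))" for c
        using that by (cases c) auto
    qed simp
    then show ?case unfolding Suc lev_Inr_Suc .
  qed
  show ?thesis using fin inf by (cases a) auto
qed

lemma initial_iso:
  assumes "Well_order \<alpha>" "Well_order \<beta>" "f ` Field \<alpha> = Field \<beta>" "inj_on f (Field \<alpha>)"
    and iff: "\<And>x y. x \<in> Field \<alpha> \<Longrightarrow> y \<in> Field \<alpha> \<Longrightarrow> (x, y) \<in> \<alpha> \<longleftrightarrow> (f x, f y) \<in> \<beta>"
    and b: "b \<in> Field \<alpha>"
  shows "initial \<alpha> b =o initial \<beta> (f b)"
proof -
  have W: "Well_order (initial \<alpha> b)" "Well_order (initial \<beta> (f b))"
    unfolding initial_def using assms(1,2) Well_order_Restr by blast+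
  have L: "Linear_order \<alpha>" "Linear_order \<beta>" using assms(1,2) unfolding well_order_on_def by auto
  have F: "Field (initial \<alpha> b) = underS \<alpha> b" "Field (initial \<beta> (f b)) = underS \<beta> (f b)"
    unfolding initial_def Field_Restr_lin[OF L(1)] Field_Restr_lin[OF L(2)]
    by (auto dest: underS_Field)
  have u: "underS \<alpha> b = {x \<in> Field \<alpha>. x \<noteq> b \<and> (x, b) \<in> \<alpha>}" "underS \<beta> (f b) = {x \<in> Field \<beta>. x \<noteq> f b \<and> (x, f b) \<in> \<beta>}"
    unfolding underS_def by (auto dest: lin_Field)
  have im: "f ` underS \<alpha> b = underS \<beta> (f b)"
  proof
    show "f ` underS \<alpha> b \<subseteq> underS \<beta> (f b)"
      unfolding u using iff[OF _ b] assms(3) inj_onD[OF assms(4) _ _ b] by auto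
    show "underS \<beta> (f b) \<subseteq> f ` underS \<alpha> b"
    proof
      fix y assume y: "y \<in> underS \<beta> (f b)"
      then obtain x where x: "x \<in> Field \<alpha>" "y = f x" unfolding u using assms(3) by blast
      then have "x \<in> underS \<alpha> b" using y iff[OF x(1) b] unfolding u by auto
      then show "y \<in> f ` underS \<alpha> b" using x by blast
    qed
  qed
  have "initial \<alpha> b \<cong> initial \<beta> (f b)"
  proof (rule chain_isoI[of _ _ f])
    show "Linear_order (initial \<alpha> b)" "Linear_order (initial \<beta> (f b))"
      using W unfolding well_order_on_def by auto
    show "f ` Field (initial \<alpha> b) = Field (initial \<beta> (f b))" unfolding F by (rule im)
    fix x y assume xy: "x \<in> Field (initial \<alpha> b)" "y \<in> Field (initial \<alpha> b)"
    then have "f x \<in> underS \<beta> (f b)" "f y \<in> underS \<beta> (f b)" using im unfolding F by auto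
    then show "(x, y) \<in> initial \<alpha> b \<longleftrightarrow> (f x, f y) \<in> initial \<beta> (f b)"
      using xy iff[of x y] unfolding F unfolding initial_def by (auto simp: u)
  qed
  then show ?thesis using W unfolding chain_iso_def ordIso_def by blast
qed

text \<open>The relation \<open>\<rho>\<^sub>\<alpha>\<close> depends on the ordinal \<open>\<alpha>\<close> only, not on its representation.\<close>

lemma rho_cong: "\<alpha> =o \<beta> \<Longrightarrow> rho A \<alpha> = rho A \<beta>"
proof (induction \<alpha> arbitrary: \<beta> rule: wf_induct_rule[OF wf_ordLess])
  case (1 \<alpha>)
  have W: "Well_order \<alpha>" "Well_order \<beta>" using 1(2) unfolding ordIso_def by auto
  obtain f where "iso \<alpha> \<beta> f" using 1(2) unfolding ordIso_def by auto
  then have f: "f ` Field \<alpha> = Field \<beta>" "inj_on f (Field \<alpha>)"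
    and iff: "\<And>x y. x \<in> Field \<alpha> \<Longrightarrow> y \<in> Field \<alpha> \<Longrightarrow> (x, y) \<in> \<alpha> \<longleftrightarrow> (f x, f y) \<in> \<beta>"
    unfolding iso_iff2 bij_betw_def by auto
  have IH: "rho A (initial \<alpha> b) = rho A (initial \<beta> (f b))" if b: "b \<in> Field \<alpha>" for b
  proof (rule 1(1))
    show "(initial \<alpha> b, \<alpha>) \<in> ordLess"
      unfolding initial_def using underS_Restr_ordLess[OF W(1)] b by blast
    show "initial \<alpha> b =o initial \<beta> (f b)" by (rule initial_iso[OF W f iff b])
  qed
  have g: "greatest \<alpha> m \<longleftrightarrow> greatest \<beta> (f m)" if "m \<in> Field \<alpha>" for m
    unfolding greatest_def f(1)[symmetric] using that iff by auto
  show ?case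
  proof (cases "Field \<alpha> = {}")
    case True
    then have "Field \<beta> = {}" using f(1) by auto
    then show ?thesis using rho_zero[OF W(1) True, of A] rho_zero[OF W(2), of A] by metis
  next
    case ne: False
    show ?thesis
    proof (cases "\<exists>m. greatest \<alpha> m")
      case True
      then obtain m where m: "greatest \<alpha> m" by blast
      then have mF: "m \<in> Field \<alpha>" unfolding greatest_def by blast
      show ?thesis
        using rho_greatest[OF W(1) m] rho_greatest[OF W(2)] g[OF mF] m IH[OF mF] by metis
    next
      case False
      have "\<nexists>m. greatest \<beta> m"
      proof
        assume "\<exists>m. greatest \<beta> m"
        then obtain m' where m': "greatest \<beta> m'" by blast
        then obtain m where "m \<in> Field \<alpha>" "m' = f m" unfolding greatest_def f(1)[symmetric] by blast
        then show False using g m' False by blast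
      qed
      moreover have "Field \<beta> \<noteq> {}" using ne f(1) by blast
      ultimately have "rho A \<beta> = (\<Union>b\<in>Field \<beta>. rho A (initial \<beta> b))" by (intro rho_limit[OF W(2)])
      also have "\<dots> = (\<Union>b\<in>Field \<alpha>. rho A (initial \<alpha> b))" unfolding f(1)[symmetric] using IH by simp
      finally show ?thesis using rho_limit[OF W(1) ne False] by simp
    qed
  qed
qed

lemma quotient_one_iff:
  assumes L: "Linear_order A" and E: "conveq A E"
  shows "quotient_chain A E \<cong> one_chain \<longleftrightarrow> Field A \<noteq> {} \<and> full A E"
proof -
  have F: "Field (quotient_chain A E) = Field A // E"
  proof
    show "Field (quotient_chain A E) \<subseteq> Field A // E" unfolding Field_def quotient_chain_def by auto
    show "Field A // E \<subseteq> Field (quotient_chain A E)"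
    proof
      fix X assume X: "X \<in> Field A // E"
      then obtain x where x: "x \<in> Field A" "X = E `` {x}" by (auto elim: quotientE)
      then have "(X, X) \<in> quotient_chain A E"
        unfolding quotient_chain_def using X conveq_refl[OF E x(1)] lin_refl[OF L x(1)] by blast
      then show "X \<in> Field (quotient_chain A E)" by (rule FieldI1)
    qed
  qed
  have F1: "Field one_chain = {()}" unfolding one_chain_def Field_def by auto
  show ?thesis
  proof
    assume "quotient_chain A E \<cong> one_chain"
    then obtain f where f: "inj_on f (Field A // E)" "f ` (Field A // E) = {()}"
      unfolding F[symmetric] F1[symmetric] by (rule chain_isoE) blast
    have "Field A \<noteq> {}" using f(2) unfolding quotient_def by auto
    moreover have "(x, y) \<in> E" if xy: "x \<in> Field A" "y \<in> Field A" for x y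
    proof -
      have "E `` {x} = E `` {y}" using inj_onD[OF f(1)] quotientI[OF xy(1)] quotientI[OF xy(2)] by simp
      then show ?thesis using conveq_class_eq[OF E xy] by simp
    qed
    ultimately show "Field A \<noteq> {} \<and> full A E" unfolding full_def by blast
  next
    assume *: "Field A \<noteq> {} \<and> full A E"
    then obtain x where x: "x \<in> Field A" by blast
    have "X = E `` {x}" if X: "X \<in> Field A // E" for X
    proof -
      obtain y where y: "y \<in> Field A" "X = E `` {y}" using X by (rule quotientE)
      then show ?thesis using * x conveq_class_eq[OF E y(1) x] unfolding full_def by blast
    qed
    moreover have "E `` {x} \<in> Field A // E" using x by (rule quotientI)
    ultimately have q: "Field A // E = {E `` {x}}" by blast
    have "(E `` {x}, E `` {x}) \<in> quotient_chain A E"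
      unfolding quotient_chain_def using q conveq_refl[OF E x] lin_refl[OF L x] by auto
    then have "iso (quotient_chain A E) one_chain (\<lambda>_. ())"
      unfolding iso_iff2 F F1 q bij_betw_def by (simp add: one_chain_def)
    then show "quotient_chain A E \<cong> one_chain" unfolding chain_iso_def by blast
  qed
qed

lemma has_rank_seg_iff:
  assumes L: "Linear_order A" shows "has_rank A (seg a) \<longleftrightarrow> rank_is A a"
proof -
  have q: "quotient_chain A (rho A (seg b)) \<cong> one_chain \<longleftrightarrow> Field A \<noteq> {} \<and> full A (lev b A)" for b
    unfolding rho_seg by (rule quotient_one_iff[OF L conveq_lev[OF L]])
  have below: "(\<exists>b. before b a \<and> \<beta> =o seg b)" if less: "\<beta> <o seg a" for \<beta> :: "(nat + nat) rel"
  proof -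
    have "Well_order \<beta>" using less unfolding ordLess_def by auto
    then obtain b where "before b a" "\<beta> =o initial (seg a) b"
      using less unfolding initial_def ordLess_iff_ordIso_Restr[OF Well_order_seg \<open>Well_order \<beta>\<close>] Field_seg by blast
    then show ?thesis using initial_seg by metis
  qed
  have seg_less: "seg b <o seg a" if "before b a" for b
    using initial_seg[OF that] underS_Restr_ordLess[OF Well_order_seg, of a b] that
    unfolding initial_def Field_seg by (metis empty_iff mem_Collect_eq)
  show ?thesis
  proof
    assume "has_rank A (seg a)"
    then show "rank_is A a" unfolding has_rank_def rank_is_def using q seg_less by blast
  next
    assume r: "rank_is A a"
    have "\<not> quotient_chain A (rho A \<beta>) \<cong> one_chain" if less: "\<beta> <o seg a" for \<beta> :: "(nat + nat) rel"
    proof -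
      obtain b where b: "before b a" "\<beta> =o seg b" using below[OF less] by blast
      then show ?thesis using rho_cong[OF b(2), of A] q[of b] r unfolding rank_is_def by simp
    qed
    then show "has_rank A (seg a)" unfolding has_rank_def using q r Well_order_seg unfolding rank_is_def by blast
  qed
qed

lemma has_rank_cong:
  fixes A :: "'a rel" and \<alpha> :: "'b rel" and \<beta> :: "'c rel"
  assumes "\<alpha> =o \<beta>" "has_rank A \<alpha>" shows "has_rank A \<beta>"
proof -
  have "\<not> quotient_chain A (rho A \<gamma>) \<cong> one_chain" if "\<gamma> <o \<beta>" for \<gamma> :: "'c rel"
  proof -
    have "\<gamma> <o \<alpha>" using that assms(1) ordIso_symmetric ordLess_ordIso_trans by blast
    then obtain p :: "'b rel" where "\<gamma> =o p" "p <o \<alpha>" unfolding internalize_ordLess[of \<gamma> \<alpha>] by blast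
    then show ?thesis using assms(2) rho_cong unfolding has_rank_def by metis
  qed
  moreover have "Well_order \<beta>" using assms(1) unfolding ordIso_def by auto
  ultimately show ?thesis using assms rho_cong[OF assms(1), of A] unfolding has_rank_def by metis
qed

lemma has_rank_natLeq_iff: "Linear_order A \<Longrightarrow> has_rank A natLeq \<longleftrightarrow> rank_is A (Inr 0)"
  using has_rank_cong[OF natLeq_seg] has_rank_cong[OF ordIso_symmetric[OF natLeq_seg]] has_rank_seg_iff by metis

lemma between_omega_omega2:
  assumes "natLeq <o \<alpha>" "\<alpha> <o natLeq \<oplus> natLeq" shows "\<exists>n. \<alpha> =o seg (Inr (Suc n))"
proof -
  have "Well_order \<alpha>" using assms(2) unfolding ordLess_def by auto
  then obtain a where a: "\<alpha> =o seg a"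
    using assms(2) ordLess_iff_ordIso_Restr[OF Well_order_omega2] unfolding seg_def initial_def by blast
  then have less: "seg (Inr 0) <o seg a"
    using assms(1) natLeq_seg ordIso_symmetric ordIso_ordLess_trans ordLess_ordIso_trans by metis
  have "before (Inr 0) a"
  proof (rule ccontr)
    assume "\<not> before (Inr 0) a"
    then have "a = Inr 0 \<or> before a (Inr 0)" by (cases a) auto
    then have "seg a = seg (Inr 0) \<or> seg a <o seg (Inr 0)"
      using initial_seg underS_Restr_ordLess[OF Well_order_seg, of "Inr 0" a]
      unfolding initial_def Field_seg by (metis empty_iff mem_Collect_eq)
    then show False using less ordLess_irreflexive ordLess_transitive by metis
  qed
  then obtain n where "a = Inr n" "0 < n" by (cases a) auto
  then show ?thesis using a by (metis gr0_conv_Suc)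
qed

section \<open>Sums and products as layered chains\<close>

lemma dir_image_chain_iso: "inj f \<Longrightarrow> A \<cong> dir_image A f"
  unfolding chain_iso_def iso_iff2 bij_betw_def dir_image_Field
  by (rule exI[of _ f]) (auto simp: dir_image_def inj_on_def)

lemma chain_prod_iff:
  "((a, b), (a', b')) \<in> A \<otimes> B \<longleftrightarrow> a \<in> Field A \<and> a' \<in> Field A \<and> b \<in> Field B \<and> b' \<in> Field B \<and>
      (b \<noteq> b' \<and> (b, b') \<in> B \<or> b = b' \<and> (a, a') \<in> A)"
  unfolding chain_prod_def by auto

lemma Field_chain_prod:
  assumes "Linear_order A" shows "Field (A \<otimes> B) = Field A \<times> Field B"
proof -
  have "(a, b) \<in> Field (A \<otimes> B) \<longleftrightarrow> a \<in> Field A \<and> b \<in> Field B" for a b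
    unfolding Field_iff[of "(a, b)"] split_paired_Ex chain_prod_iff using lin_refl[OF assms] by blast
  then show ?thesis by auto
qed

lemma Linear_order_chain_prod:
  assumes A: "Linear_order A" and B: "Linear_order B" shows "Linear_order (A \<otimes> B)"
proof (rule lin_orderI)
  fix x assume "x \<in> Field (A \<otimes> B)"
  then show "(x, x) \<in> A \<otimes> B"
    unfolding Field_chain_prod[OF A] by (cases x) (auto simp: chain_prod_iff lin_refl[OF A])
next
  fix x y z assume "(x, y) \<in> A \<otimes> B" "(y, z) \<in> A \<otimes> B"
  then show "(x, z) \<in> A \<otimes> B"
    by (cases x; cases y; cases z)
       (auto simp: chain_prod_iff intro: lin_trans[OF A] lin_trans[OF B] dest: lin_antisym[OF B])
next
  fix x y assume "(x, y) \<in> A \<otimes> B" "(y, x) \<in> A \<otimes> B"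
  then show "x = y"
    by (cases x; cases y) (auto simp: chain_prod_iff dest: lin_antisym[OF A] lin_antisym[OF B])
next
  fix x y assume "x \<in> Field (A \<otimes> B)" "y \<in> Field (A \<otimes> B)"
  then show "(x, y) \<in> A \<otimes> B \<or> (y, x) \<in> A \<otimes> B"
    unfolding Field_chain_prod[OF A]
    using lin_total[OF A, of "fst x" "fst y"] lin_total[OF B, of "snd x" "snd y"]
    by (cases x; cases y) (auto simp: chain_prod_iff)
qed

lemma Field_int_chain: "Field int_chain = UNIV"
  unfolding int_chain_def Field_def by auto

lemma Linear_order_int_chain: "Linear_order int_chain"
  by (rule lin_orderI) (auto simp: int_chain_def)

lemma layered_prod_int:
  assumes M: "uniform M" "Field M \<noteq> {}" shows "layered (M \<otimes> int_chain) snd UNIV M"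
proof -
  have LM: "Linear_order M" using M uniform_Linear by blast
  have L: "Linear_order (M \<otimes> int_chain)" by (rule Linear_order_chain_prod[OF LM Linear_order_int_chain])
  have iso: "fiber (M \<otimes> int_chain) snd i \<cong> M" for i
  proof (rule chain_isoI[OF Linear_order_fiber[OF L] LM, of fst])
    have F: "Field (fiber (M \<otimes> int_chain) snd i) = Field M \<times> {i}"
      unfolding Field_fiber[OF L] Field_chain_prod[OF LM] Field_int_chain by auto
    show "fst ` Field (fiber (M \<otimes> int_chain) snd i) = Field M" unfolding F by force
    fix x y assume "x \<in> Field (fiber (M \<otimes> int_chain) snd i)" "y \<in> Field (fiber (M \<otimes> int_chain) snd i)"
    then show "(x, y) \<in> fiber (M \<otimes> int_chain) snd i \<longleftrightarrow> (fst x, fst y) \<in> M"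
      unfolding F by (auto simp: fiber_iff chain_prod_iff Field_int_chain)
  qed
  have "isotone (M \<otimes> int_chain) snd"
    unfolding isotone_def by (auto simp: chain_prod_iff int_chain_def)
  moreover have "snd ` Field (M \<otimes> int_chain) = UNIV"
    unfolding Field_chain_prod[OF LM] Field_int_chain using M(2) by force
  moreover have "teq (fiber (M \<otimes> int_chain) snd i) M" for i
    using teq_sym[OF teq_iso[OF chain_iso_sym[OF iso] M(1)]] .
  ultimately show ?thesis unfolding layered_def using L M iso by blast
qed

lemma layered_sum_nat:
  fixes M :: "'a rel" and M' :: "'b rel"
  assumes M: "uniform M" "Field M \<noteq> {}" and M': "uniform M'" "Field M' \<noteq> {}" and t: "teq M' M"
  defines "d \<equiv> case_sum (\<lambda>_. 0) (\<lambda>(_, i). int i + 1)"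
  shows "layered (M' \<oplus> M \<otimes> natLeq) d {0..} M" and "fiber (M' \<oplus> M \<otimes> natLeq) d 0 \<cong> M'"
proof -
  let ?A = "M' \<oplus> M \<otimes> natLeq"
  have LM: "Linear_order M" "Linear_order M'" using M M' uniform_Linear by auto
  have LP: "Linear_order (M \<otimes> natLeq)" by (rule Linear_order_chain_prod[OF LM(1) natLeq_Linear_order])
  have L: "Linear_order ?A" by (rule Linear_order_chain_sum[OF LM(2) LP])
  have FA: "Field ?A = Inl ` Field M' \<union> Inr ` (Field M \<times> UNIV)"
    unfolding Field_chain_sum Field_chain_prod[OF LM(1)] Field_natLeq ..
  have iso: "isotone ?A d"
    unfolding isotone_def
  proof (intro allI impI)
    fix x y assume "(x, y) \<in> ?A"
    then show "d x \<le> d y"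
      unfolding d_def by (cases x; cases y) (auto simp: chain_prod_iff natLeq_def split: prod.splits)
  qed
  have im: "d ` Field ?A = {0..}"
  proof
    show "d ` Field ?A \<subseteq> {0..}" unfolding d_def FA by auto
    show "{0..} \<subseteq> d ` Field ?A"
    proof
      fix i :: int assume i: "i \<in> {0..}"
      obtain a b where ab: "a \<in> Field M'" "b \<in> Field M" using M(2) M'(2) by blast
      show "i \<in> d ` Field ?A"
      proof (cases "i = 0")
        case True
        then show ?thesis using ab unfolding FA d_def by (intro image_eqI[of _ _ "Inl a"]) auto
      next
        case False
        then show ?thesis
          using ab i unfolding FA d_def by (intro image_eqI[of _ _ "Inr (b, nat (i - 1))"]) auto
      qed
    qed
  qed
  show iso0: "fiber ?A d 0 \<cong> M'"
  proof (rule chain_iso_sym, rule chain_isoI[OF LM(2) Linear_order_fiber[OF L], of Inl])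
    show "Inl ` Field M' = Field (fiber ?A d 0)" unfolding Field_fiber[OF L] FA d_def by auto
    show "(x, y) \<in> M' \<longleftrightarrow> (Inl x, Inl y) \<in> fiber ?A d 0" for x y
      unfolding fiber_iff d_def by simp
  qed
  have isoS: "fiber ?A d i \<cong> M" if i: "1 \<le> i" for i
  proof (rule chain_iso_sym, rule chain_isoI[OF LM(1) Linear_order_fiber[OF L], of "\<lambda>x. Inr (x, nat (i - 1))"])
    show "(\<lambda>x. Inr (x, nat (i - 1))) ` Field M = Field (fiber ?A d i)"
      unfolding Field_fiber[OF L] FA d_def using i by (auto simp: image_iff)
    show "(x, y) \<in> M \<longleftrightarrow> (Inr (x, nat (i - 1)), Inr (y, nat (i - 1))) \<in> fiber ?A d i"
      if "x \<in> Field M" "y \<in> Field M" for x y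
      unfolding fiber_iff d_def using i that by (simp add: chain_prod_iff Field_natLeq)
  qed
  have "teq (fiber ?A d i) M" if "i \<in> {0..}" for i
  proof (cases "i = 0")
    case True
    have "teq (fiber ?A d 0) M'" using teq_sym[OF teq_iso[OF chain_iso_sym[OF iso0] M'(1)]] .
    then show ?thesis using teq_trans[OF _ t M'(2)] True by blast
  next
    case False
    then have "fiber ?A d i \<cong> M" using isoS that by simp
    then show ?thesis using teq_sym[OF teq_iso[OF chain_iso_sym M(1)]] by blast
  qed
  then show "layered ?A d {0..} M"
    unfolding layered_def using L iso im M isoS by auto
qed

lemma layered_iso_left:
  assumes A: "layered A d I M" and AB: "A \<cong> B"
  shows "\<exists>e. layered B e I M \<and> (\<forall>i. fiber B e i \<cong> fiber A d i)"
proof -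
  have L: "Linear_order A" "isotone A d" "d ` Field A = I" "uniform M" "Field M \<noteq> {}"
    using A unfolding layered_def by auto
  have LB: "Linear_order B" by (rule Linear_order_iso[OF AB L(1)])
  obtain g where g: "g ` Field B = Field A"
    "\<And>x y. x \<in> Field B \<Longrightarrow> y \<in> Field B \<Longrightarrow> (x, y) \<in> B \<longleftrightarrow> (g x, g y) \<in> A"
    using chain_iso_sym[OF AB] by (rule chain_isoE) (rule that; simp)
  define e where "e = d \<circ> g"
  have iso: "isotone B e"
    unfolding isotone_def
  proof (intro allI impI)
    fix x y assume xy: "(x, y) \<in> B"
    then have "(g x, g y) \<in> A" using g(2)[of x y] lin_Field[OF xy] by simp
    then show "e x \<le> e y" using isotoneD[OF L(2)] unfolding e_def by simp
  qed
  have im: "e ` Field B = I" unfolding e_def image_comp[symmetric] g(1) L(3) ..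
  have fib: "fiber B e i \<cong> fiber A d i" for i
  proof (rule chain_isoI[OF Linear_order_fiber[OF LB] Linear_order_fiber[OF L(1)], of g])
    show "g ` Field (fiber B e i) = Field (fiber A d i)"
      unfolding Field_fiber[OF LB] Field_fiber[OF L(1)] e_def g(1)[symmetric] by auto
    show "(x, y) \<in> fiber B e i \<longleftrightarrow> (g x, g y) \<in> fiber A d i"
      if "x \<in> Field (fiber B e i)" "y \<in> Field (fiber B e i)" for x y
      using that g(2)[of x y] unfolding Field_fiber[OF LB] fiber_iff e_def by simp
  qed
  have "teq (fiber B e i) M" if i: "i \<in> I" for i
  proof -
    have t: "teq (fiber A d i) M" and ne: "Field (fiber A d i) \<noteq> {}"
      using A i L(3) unfolding layered_def Field_fiber[OF L(1)] by auto
    have "uniform (fiber A d i)" by (rule uniform_if_teq[OF Linear_order_fiber[OF L(1)] t L(5)])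
    then have "teq (fiber B e i) (fiber A d i)" using teq_sym[OF teq_iso[OF chain_iso_sym[OF fib]]] by blast
    then show ?thesis using teq_trans[OF _ t ne] by blast
  qed
  moreover have "fiber B e i \<cong> M" if "i \<in> I" "i - 1 \<in> I" for i
    using A that chain_iso_trans[OF fib] unfolding layered_def by blast
  ultimately have "layered B e I M"
    unfolding layered_def using A[unfolded layered_def] LB iso im by (intro conjI) simp_all
  then show ?thesis using fib by blast
qed

lemma layered_iso_right:
  assumes A: "layered A d I M" and MN: "M \<cong> N" shows "layered A d I N"
proof -
  have M: "uniform M" "Field M \<noteq> {}" using A unfolding layered_def by auto
  have "teq (fiber A d i) N" if "i \<in> I" for i
    using teq_trans[OF _ teq_iso[OF MN M(1)] M(2)] A that unfolding layered_def by blast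
  moreover have "fiber A d i \<cong> N" if "i \<in> I" "i - 1 \<in> I" for i
    using A that chain_iso_trans[OF _ MN] unfolding layered_def by blast
  ultimately show ?thesis
    using A uniform_iso[OF MN M(1)] chain_iso_Field_empty[OF MN] unfolding layered_def by blast
qed

lemma layered_iso:
  assumes A: "layered A d I M" and B: "layered B e I M"
    and first: "I = {0..} \<Longrightarrow> fiber A d 0 \<cong> fiber B e 0"
  shows "A \<cong> B"
proof -
  have *: "Linear_order A" "Linear_order B" "isotone A d" "isotone B e" "d ` Field A = e ` Field B"
    using A B unfolding layered_def by auto
  show ?thesis
  proof (rule glue_fibers[OF *])
    fix i assume "i \<in> d ` Field A"
    then have i: "i \<in> I" using A unfolding layered_def by auto
    show "fiber A d i \<cong> fiber B e i"
    proof (cases "i - 1 \<in> I")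
      case True
      then have "fiber A d i \<cong> M" "fiber B e i \<cong> M" using A B i unfolding layered_def by auto
      then show ?thesis by (rule chain_iso_trans[OF _ chain_iso_sym])
    next
      case False
      then have "I = {0..}" using A unfolding layered_def by auto
      moreover then have "i = 0" using False i by simp
      ultimately show ?thesis using first by simp
    qed
  qed
qed

section \<open>The chains of the tree nodes\<close>

lemma leaves_small: "length t < 2 \<Longrightarrow> leaves (t, k) = [(t, k)]"
  by (subst leaves.simps) simp

lemma leaves_one:
  "\<not> length t < 2 \<Longrightarrow> last t = length t - 1 \<Longrightarrow> leaves (t, k) = leaves (seq_minus t, 0)"
  by (subst leaves.simps) simp

lemma leaves_two:
  "\<not> length t < 2 \<Longrightarrow> last t \<noteq> length t - 1 \<Longrightarrow>
    leaves (t, k) = leaves (seq_plus t, k + 1) @ leaves (seq_minus t, 0)"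
  by (subst leaves.simps) simp

lemma length_leaves: "length (leaves (t, k)) = ell t"
proof -
  have "length (leaves (t, k)) = length (leaves (t, l))" for l
  proof (induction "length t" arbitrary: t k l rule: less_induct)
    case less
    show ?case
    proof (cases "length t < 2")
      case True
      then show ?thesis by (simp add: leaves_small)
    next
      case big: False
      then have "length (seq_plus t) < length t" unfolding seq_plus_def by auto
      then have "length (leaves (seq_plus t, k + 1)) = length (leaves (seq_plus t, l + 1))"
        by (rule less)
      then show ?thesis
        using leaves_one[OF big, of k] leaves_one[OF big, of l] leaves_two[OF big, of k] leaves_two[OF big, of l]
        by (cases "last t = length t - 1") auto
    qed
  qed
  then show ?thesis unfolding ell_def .
qed

text \<open>The chain built from the subtree below the node \<open>v = (s; k)\<close>, with \<open>U\<^sub>l\<close> at each leaf of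
  weight \<open>l\<close>. Unlike the construction from the sequence \<open>s\<close> alone, it obeys a recursion along the
  tree, since the weight of the node is kept.\<close>

definition node_chain :: "(nat \<Rightarrow> 'a rel) \<Rightarrow> nat list \<times> nat \<Rightarrow> 'a elt rel" where
  "node_chain U v = construct (fst v) (map (U \<circ> snd) (leaves v))"

text \<open>The weights of the leaves below a node.\<close>

definition leaf_weights :: "nat list \<times> nat \<Rightarrow> nat set" where
  "leaf_weights v = snd ` set (leaves v)"

lemma construct_from_node: "construct_from s U = node_chain U (s, 0)"
proof -
  have "map (\<lambda>i. U (wt s i)) [0..<ell s] = map (U \<circ> snd) (leaves (s, 0))"
    by (rule nth_equalityI) (auto simp: ell_def wt_def)
  then show ?thesis unfolding construct_from_def node_chain_def by simp
qed

lemma weights_node: "weights s = leaf_weights (s, 0)"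
  unfolding weights_def leaf_weights_def ell_def wt_def by (auto simp: set_conv_nth image_iff)

lemma node_chain_cong: "(\<And>w. w \<in> leaf_weights v \<Longrightarrow> U w = V w) \<Longrightarrow> node_chain U v = node_chain V v"
  unfolding node_chain_def leaf_weights_def by (metis (no_types, lifting) comp_apply image_eqI map_cong)

lemma node_chain_leaf: "node_chain U ([x], k) \<cong> U k"
  unfolding node_chain_def
  by (subst construct.simps)
     (auto simp: leaves_small intro!: chain_iso_sym[OF dir_image_chain_iso] injI)

lemma leaf_weights_leaf: "leaf_weights ([x], k) = {k}"
  unfolding leaf_weights_def by (simp add: leaves_small)

lemma node_chain_one:
  assumes "length r = Suc n"
  shows "node_chain U (r @ [Suc n], k) \<cong> node_chain U (r, 0) \<otimes> int_chain"
    and "leaf_weights (r @ [Suc n], k) = leaf_weights (r, 0)"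
proof -
  have l: "leaves (r @ [Suc n], k) = leaves (r, 0)"
    using leaves_one[of "r @ [Suc n]" k] assms by (simp add: seq_minus_def)
  show "leaf_weights (r @ [Suc n], k) = leaf_weights (r, 0)" unfolding leaf_weights_def l ..
  show "node_chain U (r @ [Suc n], k) \<cong> node_chain U (r, 0) \<otimes> int_chain"
    unfolding node_chain_def l using assms
    by (subst construct.simps)
       (auto simp: seq_minus_def intro!: chain_iso_sym[OF dir_image_chain_iso] injI)
qed

lemma node_chain_two:
  assumes "length r0 = n" "x \<le> n"
  shows "node_chain U (r0 @ [y, x], k) \<cong>
      node_chain U (r0 @ [x], k + 1) \<oplus> node_chain U (r0 @ [y], 0) \<otimes> natLeq"
    and "leaf_weights (r0 @ [y, x], k) = leaf_weights (r0 @ [x], k + 1) \<union> leaf_weights (r0 @ [y], 0)"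
proof -
  have sp: "seq_plus (r0 @ [y, x]) = r0 @ [x]" "seq_minus (r0 @ [y, x]) = r0 @ [y]"
    unfolding seq_plus_def seq_minus_def by (simp_all add: butlast_append)
  have l: "leaves (r0 @ [y, x], k) = leaves (r0 @ [x], k + 1) @ leaves (r0 @ [y], 0)"
    using leaves_two[of "r0 @ [y, x]" k] assms by (simp add: sp)
  show "leaf_weights (r0 @ [y, x], k) = leaf_weights (r0 @ [x], k + 1) \<union> leaf_weights (r0 @ [y], 0)"
    unfolding leaf_weights_def l by auto
  show "node_chain U (r0 @ [y, x], k) \<cong>
      node_chain U (r0 @ [x], k + 1) \<oplus> node_chain U (r0 @ [y], 0) \<otimes> natLeq"
    unfolding node_chain_def l using assms length_leaves[of "r0 @ [x]" "k + 1"]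
    by (subst construct.simps)
       (auto simp: sp intro!: chain_iso_sym[OF dir_image_chain_iso] injI)
qed

lemma leaf_weights_le: "w \<in> leaf_weights (t, k) \<Longrightarrow> length t = Suc n \<Longrightarrow> w \<le> n + k"
proof (induction n arbitrary: t k)
  case 0
  then obtain x where "t = [x]" by (cases t) auto
  then show ?case using 0 by (simp add: leaf_weights_leaf)
next
  case (Suc n)
  then have big: "\<not> length t < 2" by simp
  have len: "length (seq_plus t) = Suc n" "length (seq_minus t) = Suc n"
    unfolding seq_plus_def seq_minus_def using Suc.prems by auto
  have "w \<in> leaf_weights (seq_plus t, k + 1) \<or> w \<in> leaf_weights (seq_minus t, 0)"
    using Suc.prems(1) leaves_one[OF big, of k] leaves_two[OF big, of k] unfolding leaf_weights_def
    by (cases "last t = length t - 1") auto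
  then show ?case using Suc.IH[OF _ len(1), of "k + 1"] Suc.IH[OF _ len(2), of 0] by auto
qed

lemma seqs_Suc: "s \<in> seqs (Suc n) \<longleftrightarrow> (\<exists>r\<in>seqs n. \<exists>x\<le>n. s = r @ [x])"
proof
  assume s: "s \<in> seqs (Suc n)"
  then have l: "length s = Suc n" unfolding seqs_def by auto
  then have e: "s = butlast s @ [last s]" by (cases s) auto
  have "butlast s \<in> seqs n" using s unfolding seqs_def by (auto simp: nth_butlast)
  moreover have "last s \<le> n" using s l unfolding seqs_def by (cases s) (auto simp: last_conv_nth)
  ultimately show "\<exists>r\<in>seqs n. \<exists>x\<le>n. s = r @ [x]" using e by blast
next
  assume "\<exists>r\<in>seqs n. \<exists>x\<le>n. s = r @ [x]"
  then show "s \<in> seqs (Suc n)" unfolding seqs_def by (auto simp: nth_append less_Suc_eq)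
qed

text \<open>The chains \<open>U\<^sub>k\<close>, \<open>k \<in> W\<close>, are uniform of rank \<open>\<omega>\<close> with tails isomorphic to \<open>F\<close>. Naming the
  common tail \<open>F\<close> makes the condition compatible with unions of weight sets.\<close>

definition good :: "'a rel \<Rightarrow> nat set \<Rightarrow> (nat \<Rightarrow> 'a rel) \<Rightarrow> bool" where
  "good F W U \<longleftrightarrow> (\<forall>k\<in>W. uniform (U k) \<and> rank_is (U k) (Inr 0) \<and> (\<forall>x\<in>Field (U k). tail (U k) x \<cong> F))"

lemma good_Un: "good F (V \<union> W) U \<longleftrightarrow> good F V U \<and> good F W U"
  unfolding good_def by blast


lemma rank_is_nonempty: "rank_is A a \<Longrightarrow> Field A \<noteq> {}"
  unfolding rank_is_def by blast

lemma leaf_weights_nonempty: "leaf_weights v \<noteq> {}"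
proof -
  have "leaves v \<noteq> []"
  proof (induction v rule: leaves.induct)
    case (1 v)
    show ?case
    proof (cases "children v = []")
      case True
      then show ?thesis by (subst leaves.simps) simp
    next
      case False
      then show ?thesis using 1[OF False] by (subst leaves.simps) (cases "children v", auto)
    qed
  qed
  then show ?thesis unfolding leaf_weights_def by simp
qed

lemma admissible_iff: "admissible s U \<longleftrightarrow> (\<exists>F. good F (weights s) U)"
proof
  assume a: "admissible s U"
  obtain k0 where k0: "k0 \<in> weights s" using leaf_weights_nonempty unfolding weights_node by blast
  have "good (common_tail (U k0)) (weights s) U"
    unfolding good_def
  proof (intro ballI conjI)
    fix k assume k: "k \<in> weights s"
    show u: "uniform (U k)" using a k unfolding admissible_def by blast
    show "rank_is (U k) (Inr 0)"
      using a k has_rank_natLeq_iff[OF uniform_Linear[OF u]] unfolding admissible_def by blast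
    fix x assume x: "x \<in> Field (U k)"
    have "(SOME x. x \<in> Field (U k)) \<in> Field (U k)" using x by (rule someI)
    then have "tail (U k) x \<cong> common_tail (U k)" using u x unfolding uniform_def common_tail_def by blast
    moreover have "common_tail (U k) \<cong> common_tail (U k0)" using a k k0 unfolding admissible_def by blast
    ultimately show "tail (U k) x \<cong> common_tail (U k0)" by (rule chain_iso_trans)
  qed
  then show "\<exists>F. good F (weights s) U" by blast
next
  assume "\<exists>F. good F (weights s) U"
  then obtain F where g: "good F (weights s) U" by blast
  have c: "common_tail (U k) \<cong> F" if k: "k \<in> weights s" for k
  proof -
    have "Field (U k) \<noteq> {}" using g k rank_is_nonempty unfolding good_def by blast
    then have "(SOME x. x \<in> Field (U k)) \<in> Field (U k)" by (simp add: some_in_eq)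
    then show ?thesis using g k unfolding good_def common_tail_def by blast
  qed
  have "common_tail (U k) \<cong> common_tail (U l)" if "k \<in> weights s" "l \<in> weights s" for k l
    by (rule chain_iso_trans[OF c[OF that(1)] chain_iso_sym[OF c[OF that(2)]]])
  moreover have "has_rank (U k) natLeq" if "k \<in> weights s" for k
    using g that has_rank_natLeq_iff[of "U k"] uniform_Linear unfolding good_def by blast
  ultimately show "admissible s U" using g unfolding admissible_def good_def by blast
qed

text \<open>The chain of a sequence of length \<open>n + 1 \<ge> 2\<close> is layered over that of the sequence without its
  last entry. In the case of a sum, the two summands are layered over the same chain (or both
  have tails \<open>F\<close>, when \<open>n = 1\<close>), and therefore have the same tails.\<close>

lemma node_chain_uniform:
  assumes "r \<in> seqs n" "x \<le> n" "good F (leaf_weights (r @ [x], k)) U"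
  shows "uniform (node_chain U (r @ [x], k)) \<and> rank_is (node_chain U (r @ [x], k)) (Inr n) \<and>
    (n = 0 \<longrightarrow> (\<forall>y\<in>Field (node_chain U (r @ [x], k)). tail (node_chain U (r @ [x], k)) y \<cong> F)) \<and>
    (0 < n \<longrightarrow> (\<exists>d I. layered (node_chain U (r @ [x], k)) d I (node_chain U (r, 0))))"
  using assms
proof (induction n arbitrary: r x k)
  case 0
  then have r: "r = []" unfolding seqs_def by simp
  have U: "uniform (U k)" "rank_is (U k) (Inr 0)" "\<forall>y\<in>Field (U k). tail (U k) y \<cong> F"
    using 0 unfolding r good_def by (simp_all add: leaf_weights_leaf)
  have iso: "U k \<cong> node_chain U ([x], k)" by (rule chain_iso_sym[OF node_chain_leaf])
  have "tail (node_chain U ([x], k)) y \<cong> F" if y: "y \<in> Field (node_chain U ([x], k))" for y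
  proof -
    obtain z where z: "z \<in> Field (U k)" using U(2) rank_is_nonempty by blast
    have "tail (U k) z \<cong> tail (node_chain U ([x], k)) y"
      using teq_iso[OF iso U(1)] y z unfolding teq_def by blast
    then show ?thesis using U(3) z chain_iso_trans[OF chain_iso_sym] by blast
  qed
  then show ?case using uniform_iso[OF iso U(1)] rank_is_iso[OF iso U(1,2)] unfolding r by simp
next
  case (Suc n)
  obtain r0 y where r: "r = r0 @ [y]" "r0 \<in> seqs n" "y \<le> n"
    using Suc.prems(1) seqs_Suc[of r n] by blast
  have len: "length r0 = n" "length r = Suc n" using r unfolding seqs_def by auto
  let ?G = "node_chain U (r @ [x], k)" and ?R = "node_chain U (r, 0)"
  have "good F (leaf_weights (r, 0)) U"
  proof (cases "x = Suc n")
    case True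
    then show ?thesis using Suc.prems(3) node_chain_one(2)[OF len(2)] by metis
  next
    case False
    then have "x \<le> n" using Suc.prems(2) by simp
    then show ?thesis using Suc.prems(3) node_chain_two(2)[OF len(1)] unfolding r by (simp add: good_Un)
  qed
  note R = Suc.IH[OF r(2,3) this[unfolded r(1)], folded r(1)]
  have Rne: "Field ?R \<noteq> {}" using R rank_is_nonempty by blast
  have "\<exists>d I. layered ?G d I ?R"
  proof (cases "x = Suc n")
    case True
    have "layered (?R \<otimes> int_chain) snd UNIV ?R" using layered_prod_int R Rne by blast
    then show ?thesis
      using layered_iso_left[OF _ chain_iso_sym[OF node_chain_one(1)[OF len(2)]]] True by blast
  next
    case False
    then have x: "x \<le> n" using Suc.prems(2) by simp
    let ?P = "node_chain U (r0 @ [x], k + 1)"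
    have "good F (leaf_weights (r0 @ [x], k + 1)) U"
      using Suc.prems(3) node_chain_two(2)[OF len(1) x] unfolding r by (simp add: good_Un)
    note P = Suc.IH[OF r(2) x this]
    have "teq ?P ?R"
    proof (cases "n = 0")
      case True
      then show ?thesis using P R chain_iso_trans[OF _ chain_iso_sym] unfolding teq_def by blast
    next
      case False
      then obtain d I e J where "layered ?P d I (node_chain U (r0, 0))" "layered ?R e J (node_chain U (r0, 0))"
        using P R by auto
      then show ?thesis using layered_teq chain_iso_refl by metis
    qed
    then obtain d where "layered (?P \<oplus> ?R \<otimes> natLeq) d {0..} ?R"
      using layered_sum_nat(1)[of ?R ?P] P R Rne rank_is_nonempty by blast
    moreover have "?P \<oplus> ?R \<otimes> natLeq \<cong> ?G"
      using chain_iso_sym[OF node_chain_two(1)[OF len(1) x]] unfolding r by simp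
    ultimately show ?thesis using layered_iso_left by blast
  qed
  then obtain d I where "layered ?G d I ?R" by blast
  then show ?case using layered_uniform layered_rank R by blast
qed

text \<open>A chain layered over the chain of \<open>r\<close> comes from a sequence extending \<open>r\<close> by one entry. If it
  is indexed by \<open>\<int>\<close>, the new entry is maximal. Otherwise its first component has the tails of
  the chain of \<open>r\<close>, hence is layered over the chain of the shortened sequence, and by induction
  comes from \<open>r\<close> with its last entry replaced. In the tree this component sits at the
  left child, which is why the weight \<open>k\<close> of the node has to be arbitrary. The splitting
  can go on down to rank \<open>\<omega>\<close>; the chain \<open>V\<close> left over is then attached to the leftmost leaf,
  of weight \<open>n + k\<close>, a weight that does not occur in the tree of \<open>r\<close>.\<close>

lemma extend_seq:
  fixes A :: "'a rel" and U :: "nat \<Rightarrow> 'a rel"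
  assumes "r \<in> seqs n" "uniform A" "rank_is A (Inr n)"
    and "n = 0 \<Longrightarrow> \<forall>x\<in>Field A. tail A x \<cong> F"
    and "0 < n \<Longrightarrow> good F (leaf_weights (r, 0)) U \<and> (\<exists>d I. layered A d I (node_chain U (r, 0)))"
  shows "\<exists>j\<le>n. \<exists>V. good F (leaf_weights (r @ [j], k)) (U(n + k := V)) \<and>
    A \<cong> node_chain (U(n + k := V)) (r @ [j], k)"
  using assms
proof (induction n arbitrary: r A k)
  case 0
  then have r: "r = []" unfolding seqs_def by simp
  have "A \<cong> node_chain (U(k := A)) ([0], k)"
    using chain_iso_sym[OF node_chain_leaf[of "U(k := A)" 0 k]] by simp
  moreover have "good F (leaf_weights ([0], k)) (U(k := A))"
    using 0 unfolding good_def leaf_weights_leaf by simp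
  ultimately show ?case unfolding r append_Nil add_0 by blast
next
  case (Suc n)
  obtain r0 y where r: "r = r0 @ [y]" "r0 \<in> seqs n" "y \<le> n"
    using Suc.prems(1) seqs_Suc[of r n] by blast
  have len: "length r0 = n" "length r = Suc n" using r unfolding seqs_def by auto
  obtain d I where gr: "good F (leaf_weights (r, 0)) U" and A: "layered A d I (node_chain U (r, 0))"
    using Suc.prems(5) by blast
  let ?R = "node_chain U (r, 0)"
  note R = node_chain_uniform[OF r(2,3) gr[unfolded r(1)], folded r(1)]
  have Rne: "Field ?R \<noteq> {}" using R rank_is_nonempty by blast
  have upd: "(U(Suc n + k := V)) w = U w" if "w \<in> leaf_weights (r, 0)" for w V
    using leaf_weights_le[OF that len(2)] by simp
  have Rupd: "node_chain (U(Suc n + k := V)) (r, 0) = ?R" for V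
    by (rule node_chain_cong[OF upd])
  have grupd: "good F (leaf_weights (r, 0)) (U(Suc n + k := V))" for V
    using gr upd[of _ V] unfolding good_def by simp
  consider "I = UNIV" | "I = {0..}" using A unfolding layered_def by blast
  then show ?case
  proof cases
    case 1
    define U' where "U' = U(Suc n + k := A)"
    have "layered (?R \<otimes> int_chain) snd UNIV ?R" using layered_prod_int R Rne by blast
    then have "A \<cong> ?R \<otimes> int_chain" using layered_iso[OF A[unfolded 1]] by auto
    moreover have "?R \<otimes> int_chain \<cong> node_chain U' (r @ [Suc n], k)"
      using chain_iso_sym[OF node_chain_one(1)[OF len(2), of U' k]] unfolding U'_def Rupd .
    ultimately have "A \<cong> node_chain U' (r @ [Suc n], k)" by (rule chain_iso_trans)
    moreover have "good F (leaf_weights (r @ [Suc n], k)) U'"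
      unfolding node_chain_one(2)[OF len(2)] U'_def by (rule grupd)
    ultimately show ?thesis unfolding U'_def by blast
  next
    case 2
    define M where "M = fiber A d 0"
    have M: "uniform M" "rank_is M (Inr n)" using layered_fiber_rank[OF A, of "Inr n" 0] R unfolding M_def 2 by auto
    have MR: "teq M ?R" using A unfolding layered_def M_def 2 by simp
    have "\<exists>j\<le>n. \<exists>V. good F (leaf_weights (r0 @ [j], k + 1)) (U(n + (k + 1) := V)) \<and>
        M \<cong> node_chain (U(n + (k + 1) := V)) (r0 @ [j], k + 1)"
    proof (rule Suc.IH[OF r(2) M])
      assume n: "n = 0"
      show "\<forall>x\<in>Field M. tail M x \<cong> F"
      proof
        fix x assume x: "x \<in> Field M"
        obtain z where "z \<in> Field ?R" using Rne by blast
        then show "tail M x \<cong> F" using MR R n x chain_iso_trans unfolding teq_def by blast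
      qed
    next
      assume n: "0 < n"
      then obtain n' where n': "n = Suc n'" by (cases n) auto
      obtain r1 z where r0: "r0 = r1 @ [z]" "r1 \<in> seqs n'" "z \<le> n'"
        using r(2) seqs_Suc[of r0 n'] unfolding n' by blast
      have "leaf_weights (r0, 0) \<subseteq> leaf_weights (r, 0)"
      proof (cases "y = Suc n'")
        case True
        then show ?thesis using node_chain_one(2)[of r0 n' 0] len(1) unfolding r(1) n' by simp
      next
        case False
        then show ?thesis using node_chain_two(2)[of r1 n' y z 0] r(3) r0 unfolding r(1) n' seqs_def by auto
      qed
      then have g0: "good F (leaf_weights (r0, 0)) U" using gr unfolding good_def by blast
      note R0 = node_chain_uniform[OF r0(2,3) g0[unfolded r0(1)], folded r0(1)]
      obtain e J where e: "layered ?R e J (node_chain U (r0, 0))" using R n by blast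
      obtain e' J' and N :: "'a rel" where N: "layered M e' J' N" "rank_is N (Inr n')"
        using uniform_layered[OF M(1)] M(2) unfolding n' by blast
      have "N \<cong> node_chain U (r0, 0)"
        by (rule layered_unique[OF N e _ MR]) (use R0 in blast)
      then have "layered M e' J' (node_chain U (r0, 0))" by (rule layered_iso_right[OF N(1)])
      then show "good F (leaf_weights (r0, 0)) U \<and> (\<exists>d I. layered M d I (node_chain U (r0, 0)))"
        using g0 by blast
    qed
    then obtain j V where j: "j \<le> n" and gV: "good F (leaf_weights (r0 @ [j], k + 1)) (U(Suc n + k := V))"
      and MV: "M \<cong> node_chain (U(Suc n + k := V)) (r0 @ [j], k + 1)" by auto
    define U' where "U' = U(Suc n + k := V)"
    let ?P = "node_chain U' (r0 @ [j], k + 1)"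
    have MP: "M \<cong> ?P" using MV unfolding U'_def .
    have P: "uniform ?P" "Field ?P \<noteq> {}" "teq ?P M"
      using uniform_iso[OF MP M(1)] chain_iso_Field_empty[OF MP] rank_is_nonempty[OF M(2)]
        teq_sym[OF teq_iso[OF MP M(1)]] by auto
    have "teq ?P ?R" using teq_trans[OF P(3) MR] rank_is_nonempty[OF M(2)] by blast
    then obtain e where e: "layered (?P \<oplus> ?R \<otimes> natLeq) e {0..} ?R" "fiber (?P \<oplus> ?R \<otimes> natLeq) e 0 \<cong> ?P"
      using layered_sum_nat[of ?R ?P] R Rne P by blast
    have "A \<cong> ?P \<oplus> ?R \<otimes> natLeq"
    proof (rule layered_iso[OF A[unfolded 2] e(1)])
      show "fiber A d 0 \<cong> fiber (?P \<oplus> ?R \<otimes> natLeq) e 0"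
        using chain_iso_trans[OF MP chain_iso_sym[OF e(2)]] unfolding M_def .
    qed
    moreover have "?P \<oplus> ?R \<otimes> natLeq \<cong> node_chain U' (r @ [j], k)"
      using chain_iso_sym[OF node_chain_two(1)[OF len(1) j, of U' y k]] Rupd[of V] unfolding r U'_def by simp
    ultimately have "A \<cong> node_chain U' (r @ [j], k)" by (rule chain_iso_trans)
    moreover have "good F (leaf_weights (r @ [j], k)) U'"
      using node_chain_two(2)[OF len(1) j, of y k] gV grupd[of V] unfolding r U'_def by (simp add: good_Un)
    moreover have "j \<le> Suc n" using j by simp
    ultimately show ?thesis unfolding U'_def by blast
  qed
qed

lemma uniform_chain_classification:
  fixes A :: "'a rel"
  assumes "uniform A" "rank_is A (Inr n)"
  shows "\<exists>s\<in>seqs (Suc n). \<exists>U :: nat \<Rightarrow> 'a rel. \<exists>F. good F (leaf_weights (s, 0)) U \<and> A \<cong> node_chain U (s, 0)"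
  using assms
proof (induction n arbitrary: A)
  case 0
  obtain x where x: "x \<in> Field A" using rank_is_nonempty[OF 0(2)] by blast
  have "\<forall>y\<in>Field A. tail A y \<cong> tail A x" using 0(1) x unfolding uniform_def by blast
  then obtain j and U :: "nat \<Rightarrow> 'a rel" where
    "j \<le> 0" "good (tail A x) (leaf_weights ([] @ [j], 0)) U" "A \<cong> node_chain U ([] @ [j], 0)"
    using extend_seq[of "[]" 0 A "tail A x" undefined 0] 0 unfolding seqs_def by auto
  moreover have "[0] \<in> seqs (Suc 0)" unfolding seqs_def by simp
  ultimately show ?case unfolding le_zero_eq append_Nil by blast
next
  case (Suc n)
  obtain d I and M :: "'a rel" where M: "layered A d I M" "rank_is M (Inr n)"
    using uniform_layered[OF Suc.prems] by blast
  then have "uniform M" unfolding layered_def by blast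
  then obtain r F and U :: "nat \<Rightarrow> 'a rel" where r: "r \<in> seqs (Suc n)"
    "good F (leaf_weights (r, 0)) U" "M \<cong> node_chain U (r, 0)"
    using Suc.IH[of M] M(2) by blast
  have "layered A d I (node_chain U (r, 0))" by (rule layered_iso_right[OF M(1) r(3)])
  then obtain j and V :: "'a rel" where "j \<le> Suc n"
    "good F (leaf_weights (r @ [j], 0)) (U(Suc n + 0 := V))" "A \<cong> node_chain (U(Suc n + 0 := V)) (r @ [j], 0)"
    using extend_seq[OF r(1) Suc.prems, of F U 0] r(2) by auto
  then show ?case using seqs_Suc[of "r @ [j]" "Suc n"] r(1) by blast
qed

theorem mainTheorem1:
  shows "(\<forall>n. \<forall>s\<in>seqs (n + 1). \<forall>U :: nat \<Rightarrow> 'a rel. admissible s U \<longrightarrow>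
            uniform (construct_from s U) \<and>
            has_rank (construct_from s U) (natLeq \<oplus> natLeq_on n))
       \<and> (\<forall>(A :: 'b rel) (\<alpha> :: 'c rel).
            uniform A \<and> has_rank A \<alpha> \<and> natLeq <o \<alpha> \<and> \<alpha> <o natLeq \<oplus> natLeq \<longrightarrow>
            (\<exists>n. \<exists>s\<in>seqs (n + 1). \<exists>U :: nat \<Rightarrow> 'b rel.
               admissible s U \<and> A \<cong> construct_from s U))"
proof (intro conjI allI ballI impI; (elim conjE)?)
  fix n s and U :: "nat \<Rightarrow> 'a rel"
  assume s: "s \<in> seqs (n + 1)" and U: "admissible s U"
  obtain F where F: "good F (leaf_weights (s, 0)) U" using U unfolding admissible_iff weights_node by blast
  obtain r x where r: "r \<in> seqs n" "x \<le> n" "s = r @ [x]" using s seqs_Suc[of s n] by auto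
  have *: "uniform (node_chain U (s, 0))" "rank_is (node_chain U (s, 0)) (Inr n)"
    using node_chain_uniform[OF r(1,2) F[unfolded r(3)]] unfolding r(3) by auto
  show "uniform (construct_from s U)" unfolding construct_from_node by (rule *)
  show "has_rank (construct_from s U) (natLeq \<oplus> natLeq_on n)"
    unfolding construct_from_node seg_Inr[symmetric] has_rank_seg_iff[OF uniform_Linear[OF *(1)]] by (rule *)
next
  fix A :: "'b rel" and \<alpha> :: "'c rel"
  assume A: "uniform A" "has_rank A \<alpha>" "natLeq <o \<alpha>" "\<alpha> <o natLeq \<oplus> natLeq"
  obtain n where "\<alpha> =o seg (Inr (Suc n))" using between_omega_omega2[OF A(3,4)] by blast
  then have "rank_is A (Inr (Suc n))"
    using has_rank_cong A(2) has_rank_seg_iff[OF uniform_Linear[OF A(1)]] by blast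
  then obtain s F and U :: "nat \<Rightarrow> 'b rel" where s: "s \<in> seqs (Suc (Suc n))"
    "good F (leaf_weights (s, 0)) U" "A \<cong> node_chain U (s, 0)"
    using uniform_chain_classification[OF A(1)] by blast
  have "admissible s U" "A \<cong> construct_from s U"
    unfolding admissible_iff weights_node construct_from_node using s by blast+
  then show "\<exists>n. \<exists>s\<in>seqs (n + 1). \<exists>U :: nat \<Rightarrow> 'b rel. admissible s U \<and> A \<cong> construct_from s U"
    using s(1) unfolding Suc_eq_plus1 by blast
qed

end
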